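(* Let $\mathcal{Y}_1,\mathcal{Y}_2\subset\mathbb{R}$ and $\mathcal{X}\subset\mathbb{R}^q$ be Polish, $\mathcal{S}=\mathcal{Y}_1\times\mathcal{Y}_2\times\mathcal{X}$, $\mathcal{V}=(\mathcal{Y}_1\times\mathcal{X})\times(\mathcal{Y}_2\times\mathcal{X})$, and let $\mu_{\ell3}=\mathrm{Law}(Y_\ell,X)\in\mathcal{P}(\mathcal{Y}_\ell\times\mathcal{X})$, $\ell=1,2$, where $Y_1,Y_2$ are potential outcomes and $X$ is a covariate. Let $d:\mathcal{X}\to\{0,1\}$ be a measurable policy function. Consider the costs $$c_\ell(s_\ell,s_\ell')=|y_\ell-y_\ell'|+\|x_\ell-x_\ell'\|_2,\qquad s_\ell=(y_\ell,x_\ell),\ s_\ell'=(y_\ell',x_\ell'),\ \ell=1,2.$$ Assume that $Y$ is unbounded and that $\mathbb{E}|Y_1|$, $\mathbb{E}|Y_2|$ and $\mathbb{E}\|X\|_2^2$ are finite. Let $\delta=(\delta_1,\delta_2)\in\mathbb{R}_+^2$ and $$\mathrm{RW}(d)=\inf_{\gamma\in\Sigma(\delta)}\mathbb{E}_\gamma[Y_1(1-d(X))+Y_2d(X)].$$ Then: (i) the robust welfare function $\mathrm{RW}(d)$ based on $\Sigma(\delta)$ has the dual reformulation $$\mathrm{RW}(d)=\sup_{\lambda\ge1}\left[\inf_{\pi\in\Pi(\mu_{13},\mu_{23})}\int_{\mathcal{V}}\min\{y_2+\varphi_{\lambda,1}(x_1,x_2),\ y_1+\varphi_{\lambda,0}(x_1,x_2)\}\,d\pi(v)-\langle\lambda,\delta\rangle\right],$$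 where $v=(y_1,x_1,y_2,x_2)$, $\lambda=(\lambda_1,\lambda_2)$, and $$\varphi_{\lambda,0}(x_1,x_2)=\min_{x':\,d(x')=0}\big(\lambda_1\|x_1-x'\|_2+\lambda_2\|x_2-x'\|_2\big),$$ $$\varphi_{\lambda,1}(x_1,x_2)=\min_{x':\,d(x')=1}\big(\lambda_1\|x_1-x'\|_2+\lambda_2\|x_2-x'\|_2\big);$$ (ii) when $\delta_0=\delta_1=\delta_2$, $\mathrm{RW}(d)\le\mathrm{RW}_0^*(d)$, where $\mathrm{RW}_0^*(d)=\inf_{\gamma\in\Sigma_0^*(\delta_0)}\mathbb{E}_\gamma[Y_1(1-d(X))+Y_2d(X)]$ is the robust welfare function based on the reference measure $\pi^*=\int\max\{\mu_{1|3}+\mu_{2|3}-1,0\}\,d\mu_3$.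
   Context: $\mathcal{P}(\cdot)$ denotes Borel probability measures and $\Pi(\mu,\nu)$ couplings; $\mathbb{R}_+^2$ is the set of vectors with nonnegative coordinates; $\lambda\ge1$ means $\lambda_1\ge1$ and $\lambda_2\ge1$. $\mathbb{E}_\gamma$ is the expectation when $(Y_1,Y_2,X)$ has law $\gamma$. Setting: $D\in\{0,1\}$ is a binary treatment, $Y_1$ and $Y_2$ are the potential outcomes under $D=0$ and $D=1$, and $Y=DY_2+(1-D)Y_1$ is the observed outcome. Selection on observables holds: $(Y_1,Y_2)$ is independent of $D$ conditional on $X$, and $0<\mathbb{P}(D=1\mid X=x)<1$ for all $x\in\mathcal{X}$; hence $\mu_{13}$ and $\mu_{23}$ are identified. They share the same projection $\mu_3$ on $\mathcal{X}$. $\Sigma(\delta)=\{\gamma\in\mathcal{P}(\mathcal{S}):\boldsymbol{K}_\ell(\mu_{\ell3},\gamma_{\ell3})\le\delta_\ell,\ \ell=1,2\}$, where $\gamma_{\ell3}$ is the projection of $\gamma$ on $\mathcal{Y}_\ell\times\mathcal{X}$ and $\boldsymbol{K}_\ell(\mu,\nu)=\inf_{\pi\in\Pi(\mu,\nu)}\int c_\ell\,d\pi$. $\pi^*\in\mathcal{P}(\mathcal{S})$ is the measure whose projection on $\mathcal{X}$ is $\mu_3$ and under which, given $X=x$, $(Y_1,Y_2)$ has joint distribution function $(a,b)\mapsto\max\{F_1(a|x)+F_2(b|x)-1,0\}$, where $F_\ell(\cdot|x)$ is the conditional distribution function of $Y_\ell$ given $X=x$ under $\mu_{\ell3}$ (written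 $\mu_{\ell|3}$ above), so that $Y_1,Y_2$ are perfectly negatively dependent given $X$. $\Sigma_0^*(\delta_0)=\{\gamma\in\mathcal{P}(\mathcal{S}):\boldsymbol{K}_c(\pi^*,\gamma)\le\delta_0\}$ with $\boldsymbol{K}_c(\mu,\nu)=\inf_{\pi\in\Pi(\mu,\nu)}\int c\,d\pi$ and $c(s,s')=|y_1-y_1'|+|y_2-y_2'|+\|x-x'\|_2$ for $s=(y_1,y_2,x)$, $s'=(y_1',y_2',x')$.
   Formalization: "Y is unbounded" is read as both outcome spaces being unbounded below; (i) also assumes that d takes both values 0 and 1 (else a minimum is over the empty set) and, if δ₁ or δ₂ is 0, that RW is right-continuous at δ along (1,1), since (i) can fail at zero radii. *)

theory Defs
  imports "HOL-Probability.Probability"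
begin

section \<open>Optimal transport on Borel subsets of Euclidean spaces\<close>

definition polish_subset :: "'a::topological_space set \<Rightarrow> bool" where
  "polish_subset A \<longleftrightarrow>
     completely_metrizable_space (top_of_set A) \<and> separable_space (top_of_set A)"

abbreviation borel_on :: "'a::topological_space set \<Rightarrow> 'a measure" where
  "borel_on A \<equiv> restrict_space borel A"

definition prob_measures_on :: "'a::topological_space set \<Rightarrow> 'a measure set" where
  "prob_measures_on A = {\<gamma>. prob_space \<gamma> \<and> sets \<gamma> = sets (borel_on A)}"

definition couplings :: "'a measure \<Rightarrow> 'b measure \<Rightarrow> ('a \<times> 'b) measure set" where
  "couplings \<mu> \<nu> =
     {\<pi>. prob_space \<pi> \<and> sets \<pi> = sets (\<mu> \<Otimes>\<^sub>M \<nu>) \<and>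
          distr \<pi> \<mu> fst = \<mu> \<and> distr \<pi> \<nu> snd = \<nu>}"

definition transport_cost ::
  "('a \<Rightarrow> 'a \<Rightarrow> real) \<Rightarrow> 'a measure \<Rightarrow> 'a measure \<Rightarrow> ennreal" where
  "transport_cost c \<mu> \<nu> =
     (INF \<pi>\<in>couplings \<mu> \<nu>. \<integral>\<^sup>+ (s, s'). ennreal (c s s') \<partial>\<pi>)"

section \<open>Costs and ambiguity sets\<close>

text \<open>A point of \<open>\<S>\<close> is a nested pair \<open>(y1, y2, x)\<close>; a point of \<open>\<Y>\<^sub>\<ell> \<times> \<X>\<close> is \<open>(y, x)\<close>.
  The norm of \<open>real ^ 'q\<close> is the Euclidean norm.\<close>

definition cost_marg :: "real \<times> (real ^ 'q) \<Rightarrow> real \<times> (real ^ 'q) \<Rightarrow> real" where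
  "cost_marg = (\<lambda>(y, x) (y', x'). \<bar>y - y'\<bar> + norm (x - x'))"

definition cost_joint ::
  "real \<times> real \<times> (real ^ 'q) \<Rightarrow> real \<times> real \<times> (real ^ 'q) \<Rightarrow> real" where
  "cost_joint = (\<lambda>(y1, y2, x) (y1', y2', x'). \<bar>y1 - y1'\<bar> + \<bar>y2 - y2'\<bar> + norm (x - x'))"

definition ambiguity_set ::
  "real set \<Rightarrow> real set \<Rightarrow> (real ^ 'q) set \<Rightarrow>
   (real \<times> (real ^ 'q)) measure \<Rightarrow> (real \<times> (real ^ 'q)) measure \<Rightarrow>
   real \<Rightarrow> real \<Rightarrow> (real \<times> real \<times> (real ^ 'q)) measure set" where
  "ambiguity_set \<Y>1 \<Y>2 \<X> \<mu>13 \<mu>23 \<delta>1 \<delta>2 =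
     {\<gamma> \<in> prob_measures_on (\<Y>1 \<times> \<Y>2 \<times> \<X>).
        transport_cost cost_marg \<mu>13
          (distr \<gamma> (borel_on (\<Y>1 \<times> \<X>)) (\<lambda>(y1, y2, x). (y1, x))) \<le> ennreal \<delta>1 \<and>
        transport_cost cost_marg \<mu>23
          (distr \<gamma> (borel_on (\<Y>2 \<times> \<X>)) (\<lambda>(y1, y2, x). (y2, x))) \<le> ennreal \<delta>2}"

definition ambiguity_set_ref ::
  "real set \<Rightarrow> real set \<Rightarrow> (real ^ 'q) set \<Rightarrow>
   (real \<times> real \<times> (real ^ 'q)) measure \<Rightarrow>
   real \<Rightarrow> (real \<times> real \<times> (real ^ 'q)) measure set" where
  "ambiguity_set_ref \<Y>1 \<Y>2 \<X> \<pi>s \<delta>0 =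
     {\<gamma> \<in> prob_measures_on (\<Y>1 \<times> \<Y>2 \<times> \<X>).
        transport_cost cost_joint \<pi>s \<gamma> \<le> ennreal \<delta>0}"

section \<open>Robust welfare and its dual\<close>

definition welfare ::
  "(real ^ 'q \<Rightarrow> real) \<Rightarrow> (real \<times> real \<times> (real ^ 'q)) measure \<Rightarrow> real" where
  "welfare d \<gamma> = (\<integral> (y1, y2, x). y1 * (1 - d x) + y2 * d x \<partial>\<gamma>)"

definition robust_welfare ::
  "(real ^ 'q \<Rightarrow> real) \<Rightarrow> (real \<times> real \<times> (real ^ 'q)) measure set \<Rightarrow> ereal" where
  "robust_welfare d \<Sigma> = (INF \<gamma>\<in>\<Sigma>. ereal (welfare d \<gamma>))"

text \<open>The level set \<open>{x' \<in> \<X>. d x' = j}\<close> need not be closed, so the minimum over it is an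
  infimum. It is only meaningful when the level set is nonempty.\<close>

definition switch_cost ::
  "(real ^ 'q) set \<Rightarrow> (real ^ 'q \<Rightarrow> real) \<Rightarrow> real \<Rightarrow> real \<Rightarrow> real \<Rightarrow>
   real ^ 'q \<Rightarrow> real ^ 'q \<Rightarrow> real" where
  "switch_cost \<X> d j l1 l2 x1 x2 =
     (INF x'\<in>{x' \<in> \<X>. d x' = j}. l1 * norm (x1 - x') + l2 * norm (x2 - x'))"

text \<open>As a function of the radii, the dual value is automatically continuous along the direction
  \<open>(1, 1)\<close>: at \<open>(\<delta>1, \<delta>2)\<close> it is the supremum, over \<open>\<epsilon> > 0\<close>, of its values at
  \<open>(\<delta>1 + \<epsilon>, \<delta>2 + \<epsilon>)\<close>. The robust welfare can jump there when a radius is zero: a zero radius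
  fixes the law of the covariate, whereas an arbitrarily small positive one allows moving mass
  between the two level sets of \<open>d\<close>. At such radii the two can only agree if the robust welfare is
  continuous from the right.\<close>

definition dual_welfare ::
  "(real ^ 'q) set \<Rightarrow> (real ^ 'q \<Rightarrow> real) \<Rightarrow>
   (real \<times> (real ^ 'q)) measure \<Rightarrow> (real \<times> (real ^ 'q)) measure \<Rightarrow>
   real \<Rightarrow> real \<Rightarrow> ereal" where
  "dual_welfare \<X> d \<mu>13 \<mu>23 \<delta>1 \<delta>2 =
     (SUP (l1, l2) \<in> {1..} \<times> {1..}.
        (INF \<pi>\<in>couplings \<mu>13 \<mu>23.
           ereal (\<integral> ((y1, x1), (y2, x2)).
                    min (y2 + switch_cost \<X> d 1 l1 l2 x1 x2)
                        (y1 + switch_cost \<X> d 0 l1 l2 x1 x2) \<partial>\<pi>))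
        - ereal (l1 * \<delta>1 + l2 * \<delta>2))"

section \<open>The conditionally countermonotone reference measure\<close>

text \<open>\<open>\<kappa> x\<close> is a version, defined at every \<open>x \<in> \<X>\<close>, of the conditional law of \<open>U\<close> given \<open>V = x\<close>.
  It lives on the full Borel space of the codomain of \<open>U\<close>, so that \<open>cdf (\<kappa> x)\<close> is the usual
  conditional distribution function also when \<open>U\<close> takes its values in a proper subset.\<close>

definition regular_cond_law ::
  "'s measure \<Rightarrow> ('s \<Rightarrow> 'u::topological_space) \<Rightarrow> ('s \<Rightarrow> 'v::topological_space) \<Rightarrow> 'v set \<Rightarrow>
   ('v \<Rightarrow> 'u measure) \<Rightarrow> bool" where
  "regular_cond_law P U V \<X> \<kappa> \<longleftrightarrow>
     \<kappa> \<in> borel_on \<X> \<rightarrow>\<^sub>M prob_algebra borel \<and>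
     (\<forall>A\<in>sets borel. \<forall>B\<in>sets (borel_on \<X>).
        emeasure P {\<omega> \<in> space P. U \<omega> \<in> A \<and> V \<omega> \<in> B} =
        (\<integral>\<^sup>+ x\<in>B. emeasure (\<kappa> x) A \<partial>distr P (borel_on \<X>) V))"

definition neg_dependent_reference ::
  "real set \<Rightarrow> real set \<Rightarrow> (real ^ 'q) set \<Rightarrow>
   (real \<times> (real ^ 'q)) measure \<Rightarrow> (real \<times> (real ^ 'q)) measure \<Rightarrow>
   (real \<times> real \<times> (real ^ 'q)) measure \<Rightarrow> bool" where
  "neg_dependent_reference \<Y>1 \<Y>2 \<X> \<mu>13 \<mu>23 \<pi>s \<longleftrightarrow>
     \<pi>s \<in> prob_measures_on (\<Y>1 \<times> \<Y>2 \<times> \<X>) \<and>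
     distr \<pi>s (borel_on \<X>) (\<lambda>(y1, y2, x). x) = distr \<mu>13 (borel_on \<X>) snd \<and>
     (\<exists>\<kappa>1 \<kappa>2 \<kappa>.
        regular_cond_law \<mu>13 fst snd \<X> \<kappa>1 \<and>
        regular_cond_law \<mu>23 fst snd \<X> \<kappa>2 \<and>
        regular_cond_law \<pi>s (\<lambda>(y1, y2, x). (y1, y2)) (\<lambda>(y1, y2, x). x) \<X> \<kappa> \<and>
        (\<forall>x\<in>\<X>. \<forall>a b.
           measure (\<kappa> x) ({..a} \<times> {..b}) = max (cdf (\<kappa>1 x) a + cdf (\<kappa>2 x) b - 1) 0))"

end

theory Submission
  imports Defs
begin

text \<open>For the upper bound in (i), the triples (transport cost in the first margin, transport cost in
  the second margin, welfare), taken over all plans moving a coupling of the two margins to a law of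
  \<open>(y1, y2, x)\<close>, form a convex set. Separating it from the triples with costs at most \<open>\<delta>\<close> and
  welfare below the primal value gives multipliers for positive radii. They are at least 1 because the
  outcomes are unbounded below and can be moved at unit cost per unit of welfare. The best move then leaves
  the outcomes in place and sends the covariates to the cheaper level set of \<open>d\<close>, whose near-optimal
  points are selected measurably from a countable dense subset. Zero radii follow by passing to the limit.

  For the lower bound, near-optimal transports of the two margins have to be glued along their
  common covariate. The welfare is a sum of two terms that depend on one margin each, so it is enough to
  match the covariates up to \<open>\<epsilon>\<close> and within the same level set of \<open>d\<close>.

  For (ii), projecting a coupling of \<open>\<pi>*\<close> and \<open>\<gamma>\<close> to a margin does not increase its cost, so
  \<open>\<Sigma>*\<close> is contained in \<open>\<Sigma>\<close>.\<close>

subsection \<open>Mixtures and gluing of probability measures\<close>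

text \<open>In the dual an infimum over couplings stands inside a supremum over multipliers, so a
  direct route to (i) would have to exchange the two. Letting a plan choose the coupling of the
  sources together with the move merges this infimum with the one over the ambiguity set. What
  remains is a convex set in three real dimensions, where a hyperplane separates any two nonempty
  disjoint convex sets.

  Such a hyperplane may be vertical and then gives no multipliers. This is excluded by a Slater
  point: the true law of \<open>(Y1, Y2, X)\<close>, left in place, has both costs 0, strictly below
  the radii exactly when both radii are positive. Hence zero radii are treated apart: the dual value
  decreases in the radii, so the bound at slightly larger radii survives the limit.

  For the lower bound, optimal transports are not assumed to exist and \<open>d\<close> may jump, so
  nearness of covariates alone does not control the payoff. The proof works with arbitrarily small
  errors and makes the value of \<open>d\<close> part of what is matched.\<close>

definition mix_measure :: "real \<Rightarrow> 'a measure \<Rightarrow> 'a measure \<Rightarrow> 'a measure" where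
  "mix_measure t P Q = measure_pmf (bernoulli_pmf t) \<bind> (\<lambda>b. if b then P else Q)"

context
  fixes t :: real and P Q :: "'a measure"
  assumes t: "0 \<le> t" "t \<le> 1" and P: "prob_space P" and Q: "prob_space Q" and PQ: "sets Q = sets P"
begin

lemma mix_kernel: "(\<lambda>b. if b then P else Q) \<in> measure_pmf (bernoulli_pmf t) \<rightarrow>\<^sub>M subprob_algebra P"
  using P Q PQ by (auto simp: space_subprob_algebra prob_space_imp_subprob_space)

lemma sets_mix: "sets (mix_measure t P Q) = sets P"
  unfolding mix_measure_def by (rule sets_bind[OF sets_kernel[OF mix_kernel]]) auto

lemma space_mix: "space (mix_measure t P Q) = space P"
  by (rule sets_eq_imp_space_eq[OF sets_mix])

lemma prob_space_mix: "prob_space (mix_measure t P Q)"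
  unfolding mix_measure_def
  by (rule measure_pmf.prob_space_bind[OF _ mix_kernel]) (auto simp: P Q)

text \<open>Writing the mixture as a bind over a coin toss makes this an instance of integration
  against a bind. The measure of a set and the invariance of margins below are derived from
  it.\<close>

lemma nn_integral_mix:
  assumes f: "f \<in> borel_measurable P"
  shows "(\<integral>\<^sup>+x. f x \<partial>mix_measure t P Q) = ennreal t * (\<integral>\<^sup>+x. f x \<partial>P) + ennreal (1 - t) * (\<integral>\<^sup>+x. f x \<partial>Q)"
proof -
  have "(\<integral>\<^sup>+x. f x \<partial>mix_measure t P Q) = (\<integral>\<^sup>+b. \<integral>\<^sup>+x. f x \<partial>(if b then P else Q) \<partial>measure_pmf (bernoulli_pmf t))"
    unfolding mix_measure_def by (rule nn_integral_bind[OF f mix_kernel])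
  also have "\<dots> = ennreal t * (\<integral>\<^sup>+x. f x \<partial>P) + ennreal (1 - t) * (\<integral>\<^sup>+x. f x \<partial>Q)"
    using t by (simp add: nn_integral_bernoulli_pmf mult.commute)
  finally show ?thesis .
qed

lemma emeasure_mix:
  assumes "A \<in> sets P"
  shows "emeasure (mix_measure t P Q) A = ennreal t * emeasure P A + ennreal (1 - t) * emeasure Q A"
  using nn_integral_mix[of "indicator A"] assms by (simp add: sets_mix PQ)

lemma distr_mix:
  assumes g: "g \<in> P \<rightarrow>\<^sub>M N" and "distr P N g = N" and "distr Q N g = N"
  shows "distr (mix_measure t P Q) N g = N"
proof (rule measure_eqI)
  fix A assume "A \<in> sets (distr (mix_measure t P Q) N g)"
  then have A: "A \<in> sets N" by simp
  have gm: "g \<in> mix_measure t P Q \<rightarrow>\<^sub>M N" and gQ: "g \<in> Q \<rightarrow>\<^sub>M N"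
    using g by (simp_all add: measurable_cong_sets[OF sets_mix refl] measurable_cong_sets[OF PQ refl])
  have sp: "space Q = space P" using PQ by (rule sets_eq_imp_space_eq)
  have 1: "emeasure P (g -` A \<inter> space P) = emeasure N A"
    using emeasure_distr[OF g A] assms(2) by simp
  have 2: "emeasure Q (g -` A \<inter> space P) = emeasure N A"
    using emeasure_distr[OF gQ A] assms(3) sp by simp
  have "emeasure (distr (mix_measure t P Q) N g) A
      = ennreal t * emeasure N A + ennreal (1 - t) * emeasure N A"
    using measurable_sets[OF g A]
    by (simp add: emeasure_distr[OF gm A] space_mix emeasure_mix 1 2)
  also have "\<dots> = emeasure N A"
    using t by (simp flip: distrib_right add: ennreal_plus[symmetric] del: ennreal_plus)
  finally show "emeasure (distr (mix_measure t P Q) N g) A = emeasure N A" .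
qed simp

text \<open>For nonnegative functions the formula is inherited from \<open>nn_integral_mix\<close>,
  which also yields integrability. Signed functions follow by splitting into positive and negative
  parts.\<close>

lemma integral_mix_nonneg:
  fixes f :: "'a \<Rightarrow> real"
  assumes f: "integrable P f" "integrable Q f" and nn: "\<And>x. 0 \<le> f x"
  shows "integrable (mix_measure t P Q) f \<and>
    (\<integral>x. f x \<partial>mix_measure t P Q) = t * (\<integral>x. f x \<partial>P) + (1 - t) * (\<integral>x. f x \<partial>Q)"
proof -
  have m: "f \<in> borel_measurable P" "f \<in> borel_measurable (mix_measure t P Q)"
    using f by (auto simp: measurable_cong_sets[OF sets_mix refl])
  have "(\<integral>\<^sup>+x. ennreal (f x) \<partial>mix_measure t P Q)
      = ennreal t * (\<integral>\<^sup>+x. ennreal (f x) \<partial>P) + ennreal (1 - t) * (\<integral>\<^sup>+x. ennreal (f x) \<partial>Q)"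
    using m by (intro nn_integral_mix) auto
  also have "\<dots> = ennreal (t * (\<integral>x. f x \<partial>P) + (1 - t) * (\<integral>x. f x \<partial>Q))"
    using t f nn by (simp add: nn_integral_eq_integral ennreal_mult'' ennreal_plus)
  finally have eq: "(\<integral>\<^sup>+x. ennreal (f x) \<partial>mix_measure t P Q)
      = ennreal (t * (\<integral>x. f x \<partial>P) + (1 - t) * (\<integral>x. f x \<partial>Q))" .
  have "has_bochner_integral (mix_measure t P Q) f (t * (\<integral>x. f x \<partial>P) + (1 - t) * (\<integral>x. f x \<partial>Q))"
    using m nn eq t by (intro has_bochner_integral_nn_integral) auto
  then show ?thesis by (simp add: has_bochner_integral_iff)
qed

lemma integral_mix:
  fixes f :: "'a \<Rightarrow> real"
  assumes f: "integrable P f" "integrable Q f"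
  shows "integrable (mix_measure t P Q) f"
    and "(\<integral>x. f x \<partial>mix_measure t P Q) = t * (\<integral>x. f x \<partial>P) + (1 - t) * (\<integral>x. f x \<partial>Q)"
proof -
  let ?p = "\<lambda>x. max 0 (f x)" and ?m = "\<lambda>x. max 0 (- f x)"
  have fe: "f = (\<lambda>x. ?p x - ?m x)" by (auto simp: fun_eq_iff)
  have ip: "integrable P ?p" "integrable Q ?p" "integrable P ?m" "integrable Q ?m" using f by auto
  have p: "integrable (mix_measure t P Q) ?p \<and>
    (\<integral>x. ?p x \<partial>mix_measure t P Q) = t * (\<integral>x. ?p x \<partial>P) + (1 - t) * (\<integral>x. ?p x \<partial>Q)"
    using ip by (intro integral_mix_nonneg) auto
  have m: "integrable (mix_measure t P Q) ?m \<and>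
    (\<integral>x. ?m x \<partial>mix_measure t P Q) = t * (\<integral>x. ?m x \<partial>P) + (1 - t) * (\<integral>x. ?m x \<partial>Q)"
    using ip by (intro integral_mix_nonneg) auto
  have "has_bochner_integral (mix_measure t P Q) (\<lambda>x. ?p x - ?m x)
     ((t * (\<integral>x. ?p x \<partial>P) + (1 - t) * (\<integral>x. ?p x \<partial>Q)) - (t * (\<integral>x. ?m x \<partial>P) + (1 - t) * (\<integral>x. ?m x \<partial>Q)))"
    using p m by (intro has_bochner_integral_diff) (auto simp: has_bochner_integral_iff)
  moreover have fP: "(\<integral>x. f x \<partial>P) = (\<integral>x. ?p x \<partial>P) - (\<integral>x. ?m x \<partial>P)"
    by (subst fe) (rule Bochner_Integration.integral_diff[OF ip(1,3)])
  moreover have fQ: "(\<integral>x. f x \<partial>Q) = (\<integral>x. ?p x \<partial>Q) - (\<integral>x. ?m x \<partial>Q)"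
    by (subst fe) (rule Bochner_Integration.integral_diff[OF ip(2,4)])
  have "(t * (\<integral>x. ?p x \<partial>P) + (1 - t) * (\<integral>x. ?p x \<partial>Q)) - (t * (\<integral>x. ?m x \<partial>P) + (1 - t) * (\<integral>x. ?m x \<partial>Q))
      = t * (\<integral>x. f x \<partial>P) + (1 - t) * (\<integral>x. f x \<partial>Q)"
    unfolding fP fQ by (simp add: algebra_simps)
  ultimately have "has_bochner_integral (mix_measure t P Q) f (t * (\<integral>x. f x \<partial>P) + (1 - t) * (\<integral>x. f x \<partial>Q))"
    by (simp only: flip: fe)
  then show "integrable (mix_measure t P Q) f"
    "(\<integral>x. f x \<partial>mix_measure t P Q) = t * (\<integral>x. f x \<partial>P) + (1 - t) * (\<integral>x. f x \<partial>Q)"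
    by (simp_all add: has_bochner_integral_iff)
qed

end

text \<open>The weight is the density, with respect to the product, of drawing the second point from
  \<open>Q\<close> conditioned on the class of the first. Integrating out the second point leaves
  total weight 1. Equality of the class laws makes the situation symmetric, so both margins of the
  gluing come from this lemma.\<close>

lemma class_weight_integral:
  fixes K :: "'a \<Rightarrow> 'k::countable" and L :: "'b \<Rightarrow> 'k"
  assumes P: "prob_space P" and Q: "prob_space Q"
    and K: "K \<in> P \<rightarrow>\<^sub>M count_space UNIV" and L: "L \<in> Q \<rightarrow>\<^sub>M count_space UNIV"
    and KL: "distr P (count_space UNIV) K = distr Q (count_space UNIV) L"
    and A: "A \<in> sets P"
  shows "(\<integral>\<^sup>+u. (\<integral>\<^sup>+v. (if K u = L v then inverse (emeasure Q (L -` {K u} \<inter> space Q)) else 0) \<partial>Q)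
      * indicator A u \<partial>P) = emeasure P A"
proof -
  interpret P: prob_space P by fact
  interpret Q: prob_space Q by fact
  let ?p = "\<lambda>k. emeasure Q (L -` {k} \<inter> space Q)"
  have pk: "emeasure P (K -` {k} \<inter> space P) = ?p k" for k
    using emeasure_distr[OF K, of "{k}"] emeasure_distr[OF L, of "{k}"] KL by simp
  have sL: "L -` {k} \<inter> space Q \<in> sets Q" for k using L by (rule measurable_sets) simp
  have sK: "K -` {k} \<inter> space P \<in> sets P" for k using K by (rule measurable_sets) simp
  have inner: "(\<integral>\<^sup>+v. (if k = L v then inverse (?p k) else 0) \<partial>Q) = inverse (?p k) * ?p k" for k
  proof -
    have "(\<integral>\<^sup>+v. (if k = L v then inverse (?p k) else 0) \<partial>Q)
       = (\<integral>\<^sup>+v. inverse (?p k) * indicator (L -` {k} \<inter> space Q) v \<partial>Q)"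
      by (rule nn_integral_cong) (auto simp: indicator_def)
    also have "\<dots> = inverse (?p k) * ?p k" using sL by (rule nn_integral_cmult_indicator)
    finally show ?thesis .
  qed
  \<comment> \<open>A class of mass 0 has infinite inverse mass, and there the product is 0 instead
    of 1. Such a class is also null for \<open>P\<close>, and there are only countably many of
    them.\<close>
  have "AE u in P. K u \<noteq> k" if "?p k = 0" for k
    using sK that by (subst AE_iff_measurable[OF sK[of k]]) (auto simp: pk)
  then have "AE u in P. \<forall>k. ?p k = 0 \<longrightarrow> K u \<noteq> k"
    by (subst AE_all_countable) auto
  then have "AE u in P. inverse (?p (K u)) * ?p (K u) = 1"
  proof eventually_elim
    case (elim u)
    then have "?p (K u) \<noteq> 0" by blast
    then show ?case using Q.emeasure_finite
      by (metis ennreal_inverse_mult less_top mult.commute ennreal_divide_self divide_ennreal_def infinity_ennreal_def)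
  qed
  then have "(\<integral>\<^sup>+u. (\<integral>\<^sup>+v. (if K u = L v then inverse (?p (K u)) else 0) \<partial>Q) * indicator A u \<partial>P)
     = (\<integral>\<^sup>+u. indicator A u \<partial>P)"
    unfolding inner by (intro nn_integral_cong_AE) auto
  then show ?thesis using A by simp
qed

text \<open>Two laws that agree on the classes of a countable-valued map are coupled so that the classes
  coincide, by drawing both points independently within a common class. With classes of small
  diameter this replaces the gluing lemma, and no disintegration is needed.\<close>

lemma glue_along_classes:
  fixes K :: "'a \<Rightarrow> 'k::countable" and L :: "'b \<Rightarrow> 'k"
  assumes P: "prob_space P" and Q: "prob_space Q"
    and K: "K \<in> P \<rightarrow>\<^sub>M count_space UNIV" and L: "L \<in> Q \<rightarrow>\<^sub>M count_space UNIV"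
    and KL: "distr P (count_space UNIV) K = distr Q (count_space UNIV) L"
  obtains R where "prob_space R" "sets R = sets (P \<Otimes>\<^sub>M Q)" "distr R P fst = P" "distr R Q snd = Q"
    "AE z in R. K (fst z) = L (snd z)"
proof -
  interpret P: prob_space P by fact
  interpret Q: prob_space Q by fact
  interpret PQ: pair_prob_space P Q ..
  let ?p = "\<lambda>k. emeasure Q (L -` {k} \<inter> space Q)"
  have pk: "emeasure P (K -` {k} \<inter> space P) = ?p k" for k
    using emeasure_distr[OF K, of "{k}"] emeasure_distr[OF L, of "{k}"] KL by simp
  define w where "w = (\<lambda>z. if K (fst z) = L (snd z) then inverse (?p (K (fst z))) else 0)"
  have K': "(\<lambda>z. K (fst z)) \<in> P \<Otimes>\<^sub>M Q \<rightarrow>\<^sub>M count_space UNIV"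
    by (rule measurable_compose[OF measurable_fst K])
  have L': "(\<lambda>z. L (snd z)) \<in> P \<Otimes>\<^sub>M Q \<rightarrow>\<^sub>M count_space UNIV"
    by (rule measurable_compose[OF measurable_snd L])
  have eqm: "Measurable.pred (P \<Otimes>\<^sub>M Q) (\<lambda>z. K (fst z) = L (snd z))"
    using measurable_compose_countable[OF _ K', of "\<lambda>k z. k = L (snd z)" "count_space UNIV"]
      L' by measurable
  have w: "w \<in> borel_measurable (P \<Otimes>\<^sub>M Q)"
    unfolding w_def using eqm measurable_compose[OF K', of "\<lambda>k. inverse (?p k)" borel] by measurable
  define R where "R = density (P \<Otimes>\<^sub>M Q) w"
  have sR: "sets R = sets (P \<Otimes>\<^sub>M Q)" by (simp add: R_def)
  have spR: "space R = space P \<times> space Q" by (simp add: R_def space_pair_measure)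
  have fstR: "emeasure R (A \<times> space Q) = emeasure P A" if A: "A \<in> sets P" for A
  proof -
    have "emeasure R (A \<times> space Q) = (\<integral>\<^sup>+z. w z * indicator (A \<times> space Q) z \<partial>(P \<Otimes>\<^sub>M Q))"
      unfolding R_def using A by (intro emeasure_density[OF w]) auto
    also have "\<dots> = (\<integral>\<^sup>+u. \<integral>\<^sup>+v. w (u, v) * indicator (A \<times> space Q) (u, v) \<partial>Q \<partial>P)"
      using w A by (intro Q.nn_integral_fst[symmetric] borel_measurable_times_ennreal borel_measurable_indicator) auto
    also have "\<dots> = (\<integral>\<^sup>+u. (\<integral>\<^sup>+v. (if K u = L v then inverse (?p (K u)) else 0) \<partial>Q)
      * indicator A u \<partial>P)"
    proof (rule nn_integral_cong)
      fix u assume u: "u \<in> space P"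
      have "(\<integral>\<^sup>+v. w (u, v) * indicator (A \<times> space Q) (u, v) \<partial>Q) = (\<integral>\<^sup>+v. w (u, v) * indicator A u \<partial>Q)"
        by (rule nn_integral_cong) (auto simp: indicator_def)
      also have "\<dots> = (\<integral>\<^sup>+v. w (u, v) \<partial>Q) * indicator A u"
        using measurable_Pair2[OF w u] by (rule nn_integral_multc)
      finally show "(\<integral>\<^sup>+v. w (u, v) * indicator (A \<times> space Q) (u, v) \<partial>Q)
        = (\<integral>\<^sup>+v. (if K u = L v then inverse (?p (K u)) else 0) \<partial>Q) * indicator A u"
        by (simp only: w_def fst_conv snd_conv)
    qed
    also have "\<dots> = emeasure P A" using A by (rule class_weight_integral[OF P Q K L KL])
    finally show ?thesis .
  qed
  have sndR: "emeasure R (space P \<times> B) = emeasure Q B" if B: "B \<in> sets Q" for B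
  proof -
    have "emeasure R (space P \<times> B) = (\<integral>\<^sup>+z. w z * indicator (space P \<times> B) z \<partial>(P \<Otimes>\<^sub>M Q))"
      unfolding R_def using B by (intro emeasure_density[OF w]) auto
    also have "\<dots> = (\<integral>\<^sup>+v. \<integral>\<^sup>+u. w (u, v) * indicator (space P \<times> B) (u, v) \<partial>P \<partial>Q)"
      using w B by (intro PQ.nn_integral_snd[symmetric, simplified case_prod_unfold, simplified] borel_measurable_times_ennreal borel_measurable_indicator) auto
    also have "\<dots> = (\<integral>\<^sup>+v. (\<integral>\<^sup>+u. (if L v = K u then inverse (emeasure P (K -` {L v} \<inter> space P)) else 0) \<partial>P)
      * indicator B v \<partial>Q)"
    proof (rule nn_integral_cong)
      fix v assume v: "v \<in> space Q"
      have "(\<integral>\<^sup>+u. w (u, v) * indicator (space P \<times> B) (u, v) \<partial>P) = (\<integral>\<^sup>+u. w (u, v) * indicator B v \<partial>P)"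
        by (rule nn_integral_cong) (auto simp: indicator_def)
      also have "\<dots> = (\<integral>\<^sup>+u. w (u, v) \<partial>P) * indicator B v"
        using measurable_Pair1[OF w v] by (rule nn_integral_multc)
      \<comment> \<open>By \<open>pk\<close> the class has the same mass under \<open>P\<close> and
        \<open>Q\<close>, so the same density is also correctly normalised when the first point is
        integrated out.\<close>
      also have "(\<integral>\<^sup>+u. w (u, v) \<partial>P)
        = (\<integral>\<^sup>+u. (if L v = K u then inverse (emeasure P (K -` {L v} \<inter> space P)) else 0) \<partial>P)"
        by (rule nn_integral_cong) (auto simp: w_def pk)
      finally show "(\<integral>\<^sup>+u. w (u, v) * indicator (space P \<times> B) (u, v) \<partial>P)
        = (\<integral>\<^sup>+u. (if L v = K u then inverse (emeasure P (K -` {L v} \<inter> space P)) else 0) \<partial>P) * indicator B v" .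
    qed
    also have "\<dots> = emeasure Q B" using B by (rule class_weight_integral[OF Q P L K KL[symmetric]])
    finally show ?thesis .
  qed
  have fstm: "fst \<in> R \<rightarrow>\<^sub>M P" and sndm: "snd \<in> R \<rightarrow>\<^sub>M Q"
    by (simp_all add: measurable_cong_sets[OF sR refl])
  show thesis
  proof (rule that)
    show "prob_space R"
    proof (rule prob_spaceI)
      show "emeasure R (space R) = 1" using fstR[of "space P"] by (simp add: spR P.emeasure_space_1)
    qed
    show "sets R = sets (P \<Otimes>\<^sub>M Q)" by fact
    show "distr R P fst = P"
    proof (rule measure_eqI)
      fix A assume "A \<in> sets (distr R P fst)"
      then have A: "A \<in> sets P" by simp
      have "fst -` A \<inter> space R = A \<times> space Q"
        using sets.sets_into_space[OF A] by (auto simp: spR)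
      then show "emeasure (distr R P fst) A = emeasure P A"
        by (simp add: emeasure_distr[OF fstm A] fstR[OF A])
    qed simp
    show "distr R Q snd = Q"
    proof (rule measure_eqI)
      fix A assume "A \<in> sets (distr R Q snd)"
      then have A: "A \<in> sets Q" by simp
      have "snd -` A \<inter> space R = space P \<times> A"
        using sets.sets_into_space[OF A] by (auto simp: spR)
      then show "emeasure (distr R Q snd) A = emeasure Q A"
        by (simp add: emeasure_distr[OF sndm A] sndR[OF A])
    qed simp
    show "AE z in R. K (fst z) = L (snd z)"
      unfolding R_def by (subst AE_density[OF w]) (auto simp: w_def)
  qed
qed

subsection \<open>Transport costs and the reference measure\<close>

lemma measurable_borel_on:
  assumes "f \<in> borel \<rightarrow>\<^sub>M N" "sets M = sets (borel_on A)"
  shows "f \<in> M \<rightarrow>\<^sub>M N"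
  using measurable_restrict_space1[OF assms(1), of A] by (simp only: measurable_cong_sets[OF assms(2) refl])

lemma space_borel_on: "sets M = sets (borel_on A) \<Longrightarrow> space M = A"
  using sets_eq_imp_space_eq[of M "borel_on A"] by (simp add: space_restrict_space)

lemma measurable_into_borel_on:
  assumes "f \<in> M \<rightarrow>\<^sub>M borel" "\<And>s. s \<in> space M \<Longrightarrow> f s \<in> B" "sets N = sets (borel_on B)"
  shows "f \<in> M \<rightarrow>\<^sub>M N"
  using assms(1,2) unfolding measurable_cong_sets[OF refl assms(3)] by (intro measurable_restrict_space2) auto

text \<open>By second countability the Borel sigma-algebra of the product is generated by
  rectangles, so the identity is measurable from the product of the two subspace sigma-algebras.
  Continuity of \<open>f\<close> then suffices.\<close>

lemma borel_measurable_pair_borel_on: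
  fixes f :: "'a::second_countable_topology \<times> 'b::second_countable_topology \<Rightarrow> real"
  assumes f: "continuous_on UNIV f"
    and M: "sets M = sets (borel_on A)" and N: "sets N = sets (borel_on B)"
  shows "f \<in> borel_measurable (M \<Otimes>\<^sub>M N)"
proof -
  have "(\<lambda>z. (fst z, snd z)) \<in> M \<Otimes>\<^sub>M N \<rightarrow>\<^sub>M borel \<Otimes>\<^sub>M borel"
    using measurable_compose[OF measurable_fst, of "\<lambda>x. x" M borel N]
      measurable_compose[OF measurable_snd, of "\<lambda>x. x" N borel M]
      measurable_borel_on[OF measurable_ident_sets[OF refl] M] measurable_borel_on[OF measurable_ident_sets[OF refl] N]
    by (intro measurable_Pair) auto
  then have "(\<lambda>z. z) \<in> M \<Otimes>\<^sub>M N \<rightarrow>\<^sub>M borel" by (simp add: borel_prod)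
  from measurable_compose[OF this borel_measurable_continuous_onI[OF f]] show ?thesis by simp
qed

lemma cost_marg_measurable:
  assumes "sets M = sets (borel_on A)" "sets N = sets (borel_on B)"
  shows "(\<lambda>(s, s'). cost_marg s s') \<in> borel_measurable (M \<Otimes>\<^sub>M N)"
  by (rule borel_measurable_pair_borel_on[OF _ assms])
    (auto simp: cost_marg_def case_prod_unfold intro!: continuous_intros)

lemma cost_marg_nonneg: "0 \<le> cost_marg s s'"
  by (auto simp: cost_marg_def case_prod_unfold)

text \<open>Any coupling of \<open>P\<close> and \<open>Q\<close> is carried by
  \<open>(p, q)\<close> to a coupling of the images, at no higher cost. It is applied with both maps
  equal to the projection of \<open>(y1, y2, x)\<close> to one outcome and the covariate.\<close>

lemma transport_cost_distr_le:
  assumes p: "p \<in> P \<rightarrow>\<^sub>M P'" and q: "q \<in> Q \<rightarrow>\<^sub>M Q'"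
    and c: "(\<lambda>(s, s'). c' s s') \<in> borel_measurable (P' \<Otimes>\<^sub>M Q')"
    and le: "\<And>s s'. c' (p s) (q s') \<le> c s s'"
  shows "transport_cost c' (distr P P' p) (distr Q Q' q) \<le> transport_cost c P Q"
  unfolding transport_cost_def
proof (rule INF_mono)
  fix \<pi> assume "\<pi> \<in> couplings P Q"
  then have pr: "prob_space \<pi>" and s: "sets \<pi> = sets (P \<Otimes>\<^sub>M Q)"
    and f: "distr \<pi> P fst = P" and g: "distr \<pi> Q snd = Q"
    by (auto simp: couplings_def)
  have fm: "fst \<in> \<pi> \<rightarrow>\<^sub>M P" and sm: "snd \<in> \<pi> \<rightarrow>\<^sub>M Q"
    by (simp_all add: measurable_cong_sets[OF s refl])
  let ?h = "\<lambda>z. (p (fst z), q (snd z))"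
  have h: "?h \<in> \<pi> \<rightarrow>\<^sub>M P' \<Otimes>\<^sub>M Q'"
    using measurable_compose[OF fm p] measurable_compose[OF sm q] by (rule measurable_Pair)
  let ?\<pi> = "distr \<pi> (P' \<Otimes>\<^sub>M Q') ?h"
  have 1: "distr ?\<pi> (distr P P' p) fst = distr P P' p"
  proof -
    have "distr ?\<pi> (distr P P' p) fst = distr ?\<pi> P' fst" by (rule distr_cong) auto
    also have "\<dots> = distr \<pi> P' (\<lambda>z. p (fst z))"
      by (subst distr_distr[OF _ h]) (auto simp: comp_def)
    also have "\<dots> = distr (distr \<pi> P fst) P' p" by (subst distr_distr[OF p fm]) (simp add: comp_def)
    finally show ?thesis by (simp add: f)
  qed
  have 2: "distr ?\<pi> (distr Q Q' q) snd = distr Q Q' q"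
  proof -
    have "distr ?\<pi> (distr Q Q' q) snd = distr ?\<pi> Q' snd" by (rule distr_cong) auto
    also have "\<dots> = distr \<pi> Q' (\<lambda>z. q (snd z))"
      by (subst distr_distr[OF _ h]) (auto simp: comp_def)
    also have "\<dots> = distr (distr \<pi> Q snd) Q' q" by (subst distr_distr[OF q sm]) (simp add: comp_def)
    finally show ?thesis by (simp add: g)
  qed
  have "?\<pi> \<in> couplings (distr P P' p) (distr Q Q' q)"
    using 1 2 prob_space.prob_space_distr[OF pr h] sets_pair_measure_cong[OF sets_distr sets_distr]
    by (auto simp: couplings_def)
  moreover have "(\<integral>\<^sup>+ (s, s'). ennreal (c' s s') \<partial>?\<pi>) \<le> (\<integral>\<^sup>+ (s, s'). ennreal (c s s') \<partial>\<pi>)"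
  proof -
    have "(\<integral>\<^sup>+ (s, s'). ennreal (c' s s') \<partial>?\<pi>) = (\<integral>\<^sup>+ z. ennreal (c' (p (fst z)) (q (snd z))) \<partial>\<pi>)"
      using c by (subst nn_integral_distr[OF h]) (auto simp: case_prod_unfold)
    also have "\<dots> \<le> (\<integral>\<^sup>+ (s, s'). ennreal (c s s') \<partial>\<pi>)"
      using le by (intro nn_integral_mono) (auto simp: case_prod_unfold intro!: ennreal_leI)
    finally show ?thesis .
  qed
  ultimately show "\<exists>\<pi>'\<in>couplings (distr P P' p) (distr Q Q' q).
      (\<integral>\<^sup>+ (s, s'). ennreal (c' s s') \<partial>\<pi>') \<le> (\<integral>\<^sup>+ (s, s'). ennreal (c s s') \<partial>\<pi>)"
    by blast
qed

text \<open>Letting \<open>b\<close> tend to infinity sends \<open>cdf n b\<close> to 1. The lower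
  Frechet bound then becomes \<open>max (cdf m a) 0\<close>, which is \<open>cdf m a\<close>, and a
  law on the line is determined by its distribution function.\<close>

lemma countermonotone_fst_law:
  fixes \<rho> :: "(real \<times> real) measure"
  assumes \<rho>: "prob_space \<rho>" "sets \<rho> = sets borel"
    and m: "prob_space m" "sets m = sets borel" and n: "prob_space n" "sets n = sets borel"
    and j: "\<And>a b. measure \<rho> ({..a} \<times> {..b}) = max (cdf m a + cdf n b - 1) 0"
  shows "distr \<rho> borel fst = m"
proof (rule cdf_unique)
  interpret \<rho>: prob_space \<rho> by fact
  have rd: "real_distribution m" "real_distribution n"
    using m n by (auto simp: real_distribution_def real_distribution_axioms_def sets_eq_imp_space_eq)
  have f: "fst \<in> \<rho> \<rightarrow>\<^sub>M (borel :: real measure)"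
    by (subst measurable_cong_sets[OF \<rho>(2) refl]) (intro borel_measurable_continuous_onI continuous_intros)
  show "real_distribution m" by fact
  show "real_distribution (distr \<rho> borel fst)"
    using \<rho>.prob_space_distr[OF f] by (simp add: real_distribution_def real_distribution_axioms_def)
  show "cdf (distr \<rho> borel fst) = cdf m"
  proof
    fix a
    have sr: "space \<rho> = UNIV" using sets_eq_imp_space_eq[OF \<rho>(2)] by simp
    have bs: "{..a} \<times> {..b} \<in> sets \<rho>" for b :: real
      unfolding \<rho>(2) by (intro borel_closed closed_Times closed_atMost)
    have U: "(\<Union>k. {..a} \<times> {..real k}) = {..a} \<times> (UNIV :: real set)"
      using real_arch_simple by auto
    have "(\<lambda>k. measure \<rho> ({..a} \<times> {..real k})) \<longlonglongrightarrow> measure \<rho> (\<Union>k. {..a} \<times> {..real k})"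
      using bs by (intro \<rho>.finite_Lim_measure_incseq) (auto simp: incseq_def)
    then have 1: "(\<lambda>k. measure \<rho> ({..a} \<times> {..real k})) \<longlonglongrightarrow> measure \<rho> ({..a} \<times> UNIV)"
      by (simp only: U)
    have "(\<lambda>k. cdf n (real k)) \<longlonglongrightarrow> 1"
      using real_distribution.cdf_lim_at_top_prob[OF rd(2)] filterlim_real_sequentially
      by (rule filterlim_compose)
    then have "(\<lambda>k. max (cdf m a + cdf n (real k) - 1) 0) \<longlonglongrightarrow> max (cdf m a + 1 - 1) 0"
      by (intro tendsto_intros)
    then have "(\<lambda>k. measure \<rho> ({..a} \<times> {..real k})) \<longlonglongrightarrow> cdf m a"
      by (simp add: j cdf_def)
    with 1 have "measure \<rho> ({..a} \<times> UNIV) = cdf m a" by (rule LIMSEQ_unique)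
    moreover have "fst -` {..a} \<inter> space \<rho> = {..a} \<times> UNIV" by (auto simp: sr)
    ultimately show "cdf (distr \<rho> borel fst) a = cdf m a"
      unfolding cdf_def by (simp add: measure_distr[OF f])
  qed
qed

text \<open>The formula is symmetric under exchanging the coordinates together with \<open>m\<close>
  and \<open>n\<close>, so the swapped law falls under the previous lemma.\<close>

lemma countermonotone_snd_law:
  fixes \<rho> :: "(real \<times> real) measure"
  assumes \<rho>: "prob_space \<rho>" "sets \<rho> = sets borel"
    and m: "prob_space m" "sets m = sets borel" and n: "prob_space n" "sets n = sets borel"
    and j: "\<And>a b. measure \<rho> ({..a} \<times> {..b}) = max (cdf m a + cdf n b - 1) 0"
  shows "distr \<rho> borel snd = n"
proof -
  interpret \<rho>: prob_space \<rho> by fact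
  have w: "prod.swap \<in> \<rho> \<rightarrow>\<^sub>M (borel :: (real \<times> real) measure)"
    by (subst measurable_cong_sets[OF \<rho>(2) refl], rule borel_measurable_continuous_onI)
      (auto simp: prod.swap_def intro!: continuous_intros)
  have "distr (distr \<rho> borel prod.swap) borel fst = n"
  proof (rule countermonotone_fst_law)
    show "prob_space (distr \<rho> borel prod.swap)" by (rule \<rho>.prob_space_distr[OF w])
    fix a b
    have "{..a} \<times> {..b} \<in> sets (borel :: (real \<times> real) measure)"
      by (intro borel_closed closed_Times closed_atMost)
    moreover have "prod.swap -` ({..a} \<times> {..b}) \<inter> space \<rho> = {..b} \<times> {..a}"
      using sets_eq_imp_space_eq[OF \<rho>(2)] by auto
    ultimately show "measure (distr \<rho> borel prod.swap) ({..a} \<times> {..b}) = max (cdf n a + cdf m b - 1) 0"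
      by (simp add: measure_distr[OF w] j add.commute)
  qed (use m n in auto)
  moreover have "distr (distr \<rho> borel prod.swap) borel fst = distr \<rho> borel snd"
    by (subst distr_distr[OF _ w]) (auto simp: comp_def intro!: borel_measurable_continuous_onI continuous_intros)
  ultimately show ?thesis by simp
qed

section \<open>Laws determined by rectangles and by conditional laws\<close>

lemma borel_on_pair_eqI:
  fixes \<mu> \<nu> :: "('a::second_countable_topology \<times> 'b::second_countable_topology) measure"
  assumes \<mu>: "prob_space \<mu>" "sets \<mu> = sets (borel_on (A \<times> B))"
    and \<nu>: "prob_space \<nu>" "sets \<nu> = sets (borel_on (A \<times> B))"
    and eq: "\<And>C D. C \<in> sets borel \<Longrightarrow> D \<in> sets borel \<Longrightarrow>
      emeasure \<mu> {s \<in> A \<times> B. fst s \<in> C \<and> snd s \<in> D} = emeasure \<nu> {s \<in> A \<times> B. fst s \<in> C \<and> snd s \<in> D}"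
  shows "\<mu> = \<nu>"
proof -
  interpret \<mu>: prob_space \<mu> by fact
  interpret \<nu>: prob_space \<nu> by fact
  have [simp]: "space \<mu> = A \<times> B" "space \<nu> = A \<times> B" using space_borel_on[OF \<mu>(2)] space_borel_on[OF \<nu>(2)] .
  have i: "(\<lambda>s. s) \<in> \<mu> \<rightarrow>\<^sub>M borel" "(\<lambda>s. s) \<in> \<nu> \<rightarrow>\<^sub>M borel"
    using measurable_borel_on[OF measurable_ident_sets[OF refl] \<mu>(2)]
      measurable_borel_on[OF measurable_ident_sets[OF refl] \<nu>(2)] by auto
  let ?E = "{C \<times> D | C D. C \<in> sets (borel :: 'a measure) \<and> D \<in> sets (borel :: 'b measure)}"
  have sE: "sets (borel :: ('a \<times> 'b) measure) = sigma_sets UNIV ?E"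
    using sets_pair_measure[of "borel :: 'a measure" "borel :: 'b measure"] unfolding borel_prod by simp
  have B: "C \<times> D \<in> sets borel" if "C \<in> sets borel" "D \<in> sets borel" for C :: "'a set" and D :: "'b set"
    using that pair_measureI[of C borel D borel] unfolding borel_prod by blast
  \<comment> \<open>\<open>A \<times> B\<close> is not assumed to be Borel, so the uniqueness
    argument on rectangles is run after both measures are pushed to the whole space by the identity.
    The sets of the subspace are traces of Borel sets, which brings the equality back.\<close>
  have e: "distr \<mu> borel (\<lambda>s. s) = distr \<nu> borel (\<lambda>s. s)"
  proof (rule measure_eqI_generator_eq[where E = ?E and \<Omega> = UNIV and A = "\<lambda>_. UNIV"])
    show "Int_stable ?E" by (rule Int_stable_pair_measure_generator)
    fix Z assume "Z \<in> ?E"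
    then obtain C D where Z: "Z = C \<times> D" "C \<in> sets borel" "D \<in> sets borel" by auto
    have "C \<times> D \<inter> A \<times> B = {s \<in> A \<times> B. fst s \<in> C \<and> snd s \<in> D}" by auto
    then show "emeasure (distr \<mu> borel (\<lambda>s. s)) Z = emeasure (distr \<nu> borel (\<lambda>s. s)) Z"
      using eq[OF Z(2,3)] Z(1) B[OF Z(2,3)] by (simp add: emeasure_distr[OF i(1)] emeasure_distr[OF i(2)])
  next
    show "range (\<lambda>_. UNIV) \<subseteq> ?E" by (auto intro!: exI[of _ UNIV])
  next
    fix k :: nat
    have "emeasure (distr \<mu> borel (\<lambda>s. s)) (UNIV :: ('a \<times> 'b) set) = 1"
      using prob_space.emeasure_space_1[OF \<mu>.prob_space_distr[OF i(1)]] by simp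
    then show "emeasure (distr \<mu> borel (\<lambda>s. s)) UNIV \<noteq> \<infinity>" by simp
  qed (simp_all add: sE)
  show ?thesis
  proof (rule measure_eqI)
    show "sets \<mu> = sets \<nu>" using \<mu> \<nu> by simp
    fix Z assume "Z \<in> sets \<mu>"
    then obtain Z' where Z: "Z = Z' \<inter> A \<times> B" "Z' \<in> sets borel"
      by (auto simp: \<mu>(2) sets_restrict_space)
    then show "emeasure \<mu> Z = emeasure \<nu> Z"
      using arg_cong[OF e, of "\<lambda>m. emeasure m Z'"]
      by (simp add: emeasure_distr[OF i(1)] emeasure_distr[OF i(2)])
  qed
qed

lemma regular_cond_lawD:
  assumes "regular_cond_law P U V B k" "C \<in> sets borel" "D \<in> sets (borel_on B)"
  shows "emeasure P {\<omega> \<in> space P. U \<omega> \<in> C \<and> V \<omega> \<in> D} = (\<integral>\<^sup>+ x\<in>D. emeasure (k x) C \<partial>distr P (borel_on B) V)"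
  using assms by (simp add: regular_cond_law_def)

lemma regular_cond_law_eqI:
  fixes \<mu> \<nu> :: "('a::second_countable_topology \<times> 'b::second_countable_topology) measure"
  assumes \<mu>: "prob_space \<mu>" "sets \<mu> = sets (borel_on (A \<times> B))"
    and \<nu>: "prob_space \<nu>" "sets \<nu> = sets (borel_on (A \<times> B))"
    and k: "regular_cond_law \<mu> fst snd B k" and l: "regular_cond_law \<nu> fst snd B l"
    and V: "distr \<mu> (borel_on B) snd = distr \<nu> (borel_on B) snd"
    and kl: "\<And>x. x \<in> B \<Longrightarrow> k x = l x"
  shows "\<mu> = \<nu>"
proof (rule borel_on_pair_eqI[OF \<mu> \<nu>])
  fix C :: "'a set" and D :: "'b set" assume C: "C \<in> sets borel" and D: "D \<in> sets borel"
  have D': "D \<inter> B \<in> sets (borel_on B)" using D by (auto simp: sets_restrict_space)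
  have a: "{s \<in> A \<times> B. fst s \<in> C \<and> snd s \<in> D} = {s \<in> A \<times> B. fst s \<in> C \<and> snd s \<in> D \<inter> B}" by auto
  have "emeasure \<mu> {s \<in> A \<times> B. fst s \<in> C \<and> snd s \<in> D}
      = (\<integral>\<^sup>+ x\<in>(D \<inter> B). emeasure (k x) C \<partial>distr \<mu> (borel_on B) snd)"
    unfolding a using regular_cond_lawD[OF k C D'] by (simp only: space_borel_on[OF \<mu>(2)])
  also have "\<dots> = (\<integral>\<^sup>+ x\<in>(D \<inter> B). emeasure (l x) C \<partial>distr \<nu> (borel_on B) snd)"
    unfolding V by (rule nn_integral_cong) (auto simp: space_restrict_space kl)
  also have "\<dots> = emeasure \<nu> {s \<in> A \<times> B. fst s \<in> C \<and> snd s \<in> D}"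
    unfolding a using regular_cond_lawD[OF l C D'] by (simp only: space_borel_on[OF \<nu>(2)])
  finally show "emeasure \<mu> {s \<in> A \<times> B. fst s \<in> C \<and> snd s \<in> D} = emeasure \<nu> {s \<in> A \<times> B. fst s \<in> C \<and> snd s \<in> D}" .
qed

text \<open>Intended for \<open>h\<close> dropping one outcome from \<open>(y1, y2, x)\<close> and
  \<open>g\<close> dropping the same coordinate from \<open>(y1, y2)\<close>: the conditional law of
  the remaining outcome is the image of the joint conditional law, because the covariate is
  untouched.\<close>

lemma regular_cond_law_map:
  fixes g :: "'u::topological_space \<Rightarrow> 'w::topological_space"
  assumes k: "regular_cond_law P U V B k" and g: "g \<in> borel \<rightarrow>\<^sub>M borel"
    and h: "h \<in> P \<rightarrow>\<^sub>M N" and V: "V \<in> P \<rightarrow>\<^sub>M borel_on B" and V': "V' \<in> N \<rightarrow>\<^sub>M borel_on B"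
    and U': "U' \<in> N \<rightarrow>\<^sub>M borel"
    and hU: "\<And>s. s \<in> space P \<Longrightarrow> U' (h s) = g (U s)" and hV: "\<And>s. s \<in> space P \<Longrightarrow> V' (h s) = V s"
  shows "regular_cond_law (distr P N h) U' V' B (\<lambda>x. distr (k x) borel g)"
  unfolding regular_cond_law_def
proof (intro conjI ballI)
  have km: "k \<in> borel_on B \<rightarrow>\<^sub>M prob_algebra borel" using k by (simp add: regular_cond_law_def)
  then show "(\<lambda>x. distr (k x) borel g) \<in> borel_on B \<rightarrow>\<^sub>M prob_algebra borel"
    by (rule measurable_compose[OF _ measurable_distr_prob_space[OF g]])
  fix C :: "'w set" and D assume C: "C \<in> sets borel" and D: "D \<in> sets (borel_on B)"
  have gC: "g -` C \<in> sets borel" using measurable_sets[OF g C] by simp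
  have S: "{\<omega> \<in> space (distr P N h). U' \<omega> \<in> C \<and> V' \<omega> \<in> D} \<in> sets N"
  proof -
    have "{\<omega> \<in> space (distr P N h). U' \<omega> \<in> C \<and> V' \<omega> \<in> D} = (U' -` C \<inter> space N) \<inter> (V' -` D \<inter> space N)"
      by auto
    then show ?thesis using measurable_sets[OF U' C] measurable_sets[OF V' D] by (simp only: sets.Int)
  qed
  have "emeasure (distr P N h) {\<omega> \<in> space (distr P N h). U' \<omega> \<in> C \<and> V' \<omega> \<in> D}
      = emeasure P {\<omega> \<in> space P. U \<omega> \<in> g -` C \<and> V \<omega> \<in> D}"
    using measurable_space[OF h]
    by (subst emeasure_distr[OF h S]) (auto simp: hU hV intro!: arg_cong[where f = "emeasure P"])
  also have "\<dots> = (\<integral>\<^sup>+ x\<in>D. emeasure (k x) (g -` C) \<partial>distr P (borel_on B) V)"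
    by (rule regular_cond_lawD[OF k gC D])
  also have "distr P (borel_on B) V = distr (distr P N h) (borel_on B) V'"
    by (subst distr_distr[OF V' h]) (auto simp: hV intro!: distr_cong)
  also have "(\<integral>\<^sup>+ x\<in>D. emeasure (k x) (g -` C) \<partial>distr (distr P N h) (borel_on B) V')
      = (\<integral>\<^sup>+ x\<in>D. emeasure (distr (k x) borel g) C \<partial>distr (distr P N h) (borel_on B) V')"
  proof (rule nn_integral_cong)
    fix x assume "x \<in> space (distr (distr P N h) (borel_on B) V')"
    then have "k x \<in> space (prob_algebra borel)" using measurable_space[OF km, of x] by simp
    then have sk: "sets (k x) = sets borel" by (simp add: space_prob_algebra)
    then have "g \<in> k x \<rightarrow>\<^sub>M borel" using g by (simp only: measurable_cong_sets[OF sk refl])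
    then show "emeasure (k x) (g -` C) * indicator D x = emeasure (distr (k x) borel g) C * indicator D x"
      using C sets_eq_imp_space_eq[OF sk] by (simp add: emeasure_distr)
  qed
  finally show "emeasure (distr P N h) {\<omega> \<in> space (distr P N h). U' \<omega> \<in> C \<and> V' \<omega> \<in> D}
    = (\<integral>\<^sup>+ x\<in>D. emeasure (distr (k x) borel g) C \<partial>distr (distr P N h) (borel_on B) V')" .
qed

text \<open>The conditional distribution function is prescribed at every
  \<open>x \<in> \<X>\<close>, so there the projections of \<open>\<kappa> x\<close> are exactly
  \<open>\<kappa>1 x\<close> and \<open>\<kappa>2 x\<close>. Together with the law of the covariate
  they determine the two margins. The reference fixes its covariate law through
  \<open>\<mu>\<close>, and \<open>cov\<close> transfers it to \<open>\<nu>\<close>.\<close>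

lemma reference_marginals:
  assumes ref: "neg_dependent_reference \<Y>1 \<Y>2 \<X> \<mu> \<nu> \<pi>s"
    and \<mu>: "prob_space \<mu>" "sets \<mu> = sets (borel_on (\<Y>1 \<times> \<X>))"
    and \<nu>: "prob_space \<nu>" "sets \<nu> = sets (borel_on (\<Y>2 \<times> \<X>))"
    and cov: "distr \<mu> (borel_on \<X>) snd = distr \<nu> (borel_on \<X>) snd"
  shows "distr \<pi>s (borel_on (\<Y>1 \<times> \<X>)) (\<lambda>(y1, y2, x). (y1, x)) = \<mu>"
    and "distr \<pi>s (borel_on (\<Y>2 \<times> \<X>)) (\<lambda>(y1, y2, x). (y2, x)) = \<nu>"
proof -
  let ?U = "\<lambda>(y1, y2, x). (y1, y2)" and ?V = "\<lambda>(y1, y2, x). x"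
  let ?p = "\<lambda>(y1, y2, x). (y1, x)" and ?q = "\<lambda>(y1, y2, x). (y2, x)"
  from ref obtain \<kappa>1 \<kappa>2 \<kappa> where
    pi: "\<pi>s \<in> prob_measures_on (\<Y>1 \<times> \<Y>2 \<times> \<X>)"
    and dx: "distr \<pi>s (borel_on \<X>) ?V = distr \<mu> (borel_on \<X>) snd"
    and k1: "regular_cond_law \<mu> fst snd \<X> \<kappa>1"
    and k2: "regular_cond_law \<nu> fst snd \<X> \<kappa>2"
    and k: "regular_cond_law \<pi>s ?U ?V \<X> \<kappa>"
    and cm: "\<And>x a b. x \<in> \<X> \<Longrightarrow> measure (\<kappa> x) ({..a} \<times> {..b}) = max (cdf (\<kappa>1 x) a + cdf (\<kappa>2 x) b - 1) 0"
    unfolding neg_dependent_reference_def by auto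
  have pp: "prob_space \<pi>s" and sp: "sets \<pi>s = sets (borel_on (\<Y>1 \<times> \<Y>2 \<times> \<X>))"
    using pi by (auto simp: prob_measures_on_def)
  note [simp] = space_borel_on[OF sp]
  have law: "prob_space (k x)" "sets (k x) = sets borel"
    if "regular_cond_law P U V \<X> k" "x \<in> \<X>" for P :: "'s measure" and U V k x
  proof -
    have "k x \<in> space (prob_algebra borel)"
      using that measurable_space[of k "borel_on \<X>" "prob_algebra borel" x]
      by (simp add: regular_cond_law_def space_restrict_space)
    then show "prob_space (k x)" "sets (k x) = sets borel" by (simp_all add: space_prob_algebra)
  qed
  have V: "?V \<in> \<pi>s \<rightarrow>\<^sub>M borel_on \<X>"
    by (rule measurable_into_borel_on[OF measurable_borel_on[OF _ sp]])
      (auto simp: case_prod_unfold intro!: borel_measurable_continuous_onI continuous_intros)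
  have hp: "?p \<in> \<pi>s \<rightarrow>\<^sub>M borel_on (\<Y>1 \<times> \<X>)" and hq: "?q \<in> \<pi>s \<rightarrow>\<^sub>M borel_on (\<Y>2 \<times> \<X>)"
    by (rule measurable_into_borel_on[OF measurable_borel_on[OF _ sp]];
      auto simp: case_prod_unfold intro!: borel_measurable_continuous_onI continuous_intros)+
  have fs: "fst \<in> borel_on (A \<times> \<X>) \<rightarrow>\<^sub>M (borel :: real measure)" "snd \<in> borel_on (A \<times> \<X>) \<rightarrow>\<^sub>M borel_on \<X>" for A
    by (rule measurable_borel_on[OF _ refl] measurable_into_borel_on[OF measurable_borel_on[OF _ refl] _ refl];
      auto simp: space_restrict_space intro!: borel_measurable_continuous_onI continuous_intros)+
  have bfs: "fst \<in> borel \<rightarrow>\<^sub>M (borel :: real measure)" "snd \<in> borel \<rightarrow>\<^sub>M (borel :: real measure)"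
    by (auto intro!: borel_measurable_continuous_onI continuous_intros)
  have c1: "regular_cond_law (distr \<pi>s (borel_on (\<Y>1 \<times> \<X>)) ?p) fst snd \<X> (\<lambda>x. distr (\<kappa> x) borel fst)"
    by (rule regular_cond_law_map[OF k bfs(1) hp V fs(2) fs(1)]) auto
  have c2: "regular_cond_law (distr \<pi>s (borel_on (\<Y>2 \<times> \<X>)) ?q) fst snd \<X> (\<lambda>x. distr (\<kappa> x) borel snd)"
    by (rule regular_cond_law_map[OF k bfs(2) hq V fs(2) fs(1)]) auto
  have vp: "distr (distr \<pi>s (borel_on (\<Y>1 \<times> \<X>)) ?p) (borel_on \<X>) snd = distr \<mu> (borel_on \<X>) snd"
    by (subst distr_distr[OF fs(2) hp]) (simp add: comp_def case_prod_unfold flip: dx)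
  have vq: "distr (distr \<pi>s (borel_on (\<Y>2 \<times> \<X>)) ?q) (borel_on \<X>) snd = distr \<nu> (borel_on \<X>) snd"
    unfolding cov[symmetric] by (subst distr_distr[OF fs(2) hq]) (simp add: comp_def case_prod_unfold flip: dx)
  show "distr \<pi>s (borel_on (\<Y>1 \<times> \<X>)) ?p = \<mu>"
  proof (rule regular_cond_law_eqI[OF prob_space.prob_space_distr[OF pp hp] sets_distr \<mu> c1 k1 vp])
    fix x assume x: "x \<in> \<X>"
    show "distr (\<kappa> x) borel fst = \<kappa>1 x"
      by (rule countermonotone_fst_law[OF law[OF k x] law[OF k1 x] law[OF k2 x] cm[OF x]])
  qed
  show "distr \<pi>s (borel_on (\<Y>2 \<times> \<X>)) ?q = \<nu>"
  proof (rule regular_cond_law_eqI[OF prob_space.prob_space_distr[OF pp hq] sets_distr \<nu> c2 k2 vq])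
    fix x assume x: "x \<in> \<X>"
    show "distr (\<kappa> x) borel snd = \<kappa>2 x"
      by (rule countermonotone_snd_law[OF law[OF k x] law[OF k1 x] law[OF k2 x] cm[OF x]])
  qed
qed

lemma ambiguity_set_ref_subset:
  assumes ref: "neg_dependent_reference \<Y>1 \<Y>2 \<X> \<mu> \<nu> \<pi>s"
    and \<mu>: "prob_space \<mu>" "sets \<mu> = sets (borel_on (\<Y>1 \<times> \<X>))"
    and \<nu>: "prob_space \<nu>" "sets \<nu> = sets (borel_on (\<Y>2 \<times> \<X>))"
    and cov: "distr \<mu> (borel_on \<X>) snd = distr \<nu> (borel_on \<X>) snd"
  shows "ambiguity_set_ref \<Y>1 \<Y>2 \<X> \<pi>s \<delta> \<subseteq> ambiguity_set \<Y>1 \<Y>2 \<X> \<mu> \<nu> \<delta> \<delta>"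
proof
  fix \<gamma> assume "\<gamma> \<in> ambiguity_set_ref \<Y>1 \<Y>2 \<X> \<pi>s \<delta>"
  then have g: "\<gamma> \<in> prob_measures_on (\<Y>1 \<times> \<Y>2 \<times> \<X>)" and c: "transport_cost cost_joint \<pi>s \<gamma> \<le> ennreal \<delta>"
    by (auto simp: ambiguity_set_ref_def)
  have sg: "sets \<gamma> = sets (borel_on (\<Y>1 \<times> \<Y>2 \<times> \<X>))" using g by (simp add: prob_measures_on_def)
  have sp: "sets \<pi>s = sets (borel_on (\<Y>1 \<times> \<Y>2 \<times> \<X>))"
    using ref by (simp add: neg_dependent_reference_def prob_measures_on_def)
  let ?p = "\<lambda>(y1 :: real, y2 :: real, x :: real ^ 'a). (y1, x)"
  let ?q = "\<lambda>(y1 :: real, y2 :: real, x :: real ^ 'a). (y2, x)"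
  have p: "?p \<in> m \<rightarrow>\<^sub>M borel_on (\<Y>1 \<times> \<X>)" and q: "?q \<in> m \<rightarrow>\<^sub>M borel_on (\<Y>2 \<times> \<X>)"
    if m: "sets m = sets (borel_on (\<Y>1 \<times> \<Y>2 \<times> \<X>))" for m
    by (rule measurable_into_borel_on[OF measurable_borel_on[OF _ m]];
      auto simp: case_prod_unfold space_borel_on[OF m] intro!: borel_measurable_continuous_onI continuous_intros)+
  have "transport_cost cost_marg \<mu> (distr \<gamma> (borel_on (\<Y>1 \<times> \<X>)) ?p) \<le> transport_cost cost_joint \<pi>s \<gamma>"
    by (subst reference_marginals(1)[OF assms, symmetric],
        rule transport_cost_distr_le[OF p[OF sp] p[OF sg] cost_marg_measurable[OF refl refl]])
      (auto simp: cost_marg_def cost_joint_def case_prod_unfold)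
  moreover have "transport_cost cost_marg \<nu> (distr \<gamma> (borel_on (\<Y>2 \<times> \<X>)) ?q) \<le> transport_cost cost_joint \<pi>s \<gamma>"
    by (subst reference_marginals(2)[OF assms, symmetric],
        rule transport_cost_distr_le[OF q[OF sp] q[OF sg] cost_marg_measurable[OF refl refl]])
      (auto simp: cost_marg_def cost_joint_def case_prod_unfold)
  ultimately show "\<gamma> \<in> ambiguity_set \<Y>1 \<Y>2 \<X> \<mu> \<nu> \<delta> \<delta>"
    using g c by (auto simp: ambiguity_set_def)
qed

subsection \<open>Switching costs\<close>

context
  fixes \<X> :: "(real ^ 'q) set" and d :: "real ^ 'q \<Rightarrow> real" and j l1 l2 :: real
  assumes ne: "\<exists>x\<in>\<X>. d x = j" and l: "0 \<le> l1" "0 \<le> l2"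
begin

lemma switch_cost_le:
  assumes "x' \<in> \<X>" "d x' = j"
  shows "switch_cost \<X> d j l1 l2 x1 x2 \<le> l1 * norm (x1 - x') + l2 * norm (x2 - x')"
  unfolding switch_cost_def using assms l by (intro cINF_lower bdd_belowI2[where m = 0]) auto

lemma switch_cost_greatest:
  assumes "\<And>x'. x' \<in> \<X> \<Longrightarrow> d x' = j \<Longrightarrow> m \<le> l1 * norm (x1 - x') + l2 * norm (x2 - x')"
  shows "m \<le> switch_cost \<X> d j l1 l2 x1 x2"
  unfolding switch_cost_def using assms ne by (intro cINF_greatest) auto

lemma switch_cost_nonneg: "0 \<le> switch_cost \<X> d j l1 l2 x1 x2"
  using l by (intro switch_cost_greatest) auto

text \<open>By the triangle inequality each competitor is Lipschitz in \<open>(x1, x2)\<close> with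
  the same constants, and an infimum inherits them. This yields continuity, hence measurability,
  whatever the shape of the level set.\<close>

lemma switch_cost_shift:
  "switch_cost \<X> d j l1 l2 x1 x2 \<le> switch_cost \<X> d j l1 l2 z1 z2 + (l1 * norm (x1 - z1) + l2 * norm (x2 - z2))"
proof -
  have "switch_cost \<X> d j l1 l2 x1 x2 - (l1 * norm (x1 - z1) + l2 * norm (x2 - z2)) \<le> switch_cost \<X> d j l1 l2 z1 z2"
  proof (rule switch_cost_greatest)
    fix x' assume x': "x' \<in> \<X>" "d x' = j"
    have "l1 * norm (x1 - x') \<le> l1 * (norm (x1 - z1) + norm (z1 - x'))"
      "l2 * norm (x2 - x') \<le> l2 * (norm (x2 - z2) + norm (z2 - x'))"
      using l norm_triangle_ineq[of "x1 - z1" "z1 - x'"] norm_triangle_ineq[of "x2 - z2" "z2 - x'"]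
      by (auto intro!: mult_left_mono)
    then show "switch_cost \<X> d j l1 l2 x1 x2 - (l1 * norm (x1 - z1) + l2 * norm (x2 - z2))
        \<le> l1 * norm (z1 - x') + l2 * norm (z2 - x')"
      using switch_cost_le[OF x', of x1 x2] by (simp add: distrib_left)
  qed
  then show ?thesis by simp
qed

lemma continuous_switch_cost: "continuous_on UNIV (\<lambda>p. switch_cost \<X> d j l1 l2 (fst p) (snd p))"
proof (rule lipschitz_on_continuous_on[where L = "l1 + l2"], rule lipschitz_onI)
  fix p r :: "(real ^ 'q) \<times> (real ^ 'q)"
  have "l1 * norm (fst p - fst r) + l2 * norm (snd p - snd r) \<le> (l1 + l2) * dist p r"
    using l dist_fst_le[of p r] dist_snd_le[of p r]
    by (auto simp: dist_norm distrib_right intro!: add_mono mult_left_mono)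
  then show "dist (switch_cost \<X> d j l1 l2 (fst p) (snd p)) (switch_cost \<X> d j l1 l2 (fst r) (snd r)) \<le> (l1 + l2) * dist p r"
    using switch_cost_shift[of "fst p" "snd p" "fst r" "snd r"] switch_cost_shift[of "fst r" "snd r" "fst p" "snd p"]
    by (simp add: dist_real_def norm_minus_commute abs_le_iff)
qed (use l in simp)

lemma near_optimal_switch:
  assumes e: "0 < e"
  obtains h where "h \<in> borel \<rightarrow>\<^sub>M borel" "\<And>p. h p \<in> \<X>" "\<And>p. d (h p) = j"
    "\<And>p. l1 * norm (fst p - h p) + l2 * norm (snd p - h p) \<le> switch_cost \<X> d j l1 l2 (fst p) (snd p) + e"
proof -
  let ?L = "{x \<in> \<X>. d x = j}"
  obtain T where T: "countable T" "T \<subseteq> ?L" "?L \<subseteq> closure T" by (rule separable)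
  have Tne: "T \<noteq> {}" using T(3) ne by auto
  define t where "t = from_nat_into T"
  have tT: "t n \<in> T" for n unfolding t_def by (rule from_nat_into[OF Tne])
  let ?c = "\<lambda>p x. l1 * norm (fst p - x) + l2 * norm (snd p - x)"
  let ?Q = "\<lambda>n p. ?c p (t n) \<le> switch_cost \<X> d j l1 l2 (fst p) (snd p) + e"
  have ex: "\<exists>n. ?Q n p" for p
  proof -
    have "\<exists>x\<in>?L. ?c p x < switch_cost \<X> d j l1 l2 (fst p) (snd p) + e / 2"
      using switch_cost_greatest[of "switch_cost \<X> d j l1 l2 (fst p) (snd p) + e / 2" "fst p" "snd p"] e
      by (force simp: not_le)
    then obtain x where x: "x \<in> ?L" "?c p x < switch_cost \<X> d j l1 l2 (fst p) (snd p) + e / 2" by auto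
    \<comment> \<open>Replacing \<open>x\<close> by a point this close changes the cost by at most
      \<open>e / 2\<close>, the other half of the error being spent on the choice of
      \<open>x\<close>. The summand 1 keeps the denominator positive when both weights
      vanish.\<close>
    have pos: "0 < e / (2 * (l1 + l2 + 1))" using e l by auto
    obtain y where y: "y \<in> T" "dist y x < e / (2 * (l1 + l2 + 1))"
      using x(1) T(3) pos closure_approachable by blast
    obtain n where n: "y = t n" using y(1) T(1) from_nat_into_surj[of T y] unfolding t_def by auto
    have "norm (x - y) * (2 * (l1 + l2 + 1)) < e"
      using y(2) l by (simp add: dist_norm norm_minus_commute field_simps)
    then have yx: "2 * ((l1 + l2) * norm (x - y)) + 2 * norm (x - y) < e" by (simp add: algebra_simps)
    have "l1 * norm (fst p - y) \<le> l1 * (norm (fst p - x) + norm (x - y))"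
      "l2 * norm (snd p - y) \<le> l2 * (norm (snd p - x) + norm (x - y))"
      using l norm_triangle_ineq[of "fst p - x" "x - y"] norm_triangle_ineq[of "snd p - x" "x - y"]
      by (auto intro!: mult_left_mono)
    then have "?c p y \<le> ?c p x + (l1 + l2) * norm (x - y)" by (simp add: algebra_simps)
    moreover have "(l1 + l2) * norm (x - y) \<le> e / 2" using yx norm_ge_zero[of "x - y"] by linarith
    ultimately have "?c p y \<le> switch_cost \<X> d j l1 l2 (fst p) (snd p) + e" using x(2) by simp
    then show ?thesis using n by blast
  qed
  \<comment> \<open>Taking the least admissible index makes the choice measurable, since for each
    index admissibility compares two continuous functions of \<open>p\<close>.\<close>
  define h where "h = (\<lambda>p. t (LEAST n. ?Q n p))"
  show thesis
  proof
    have "(\<lambda>p. LEAST n. ?Q n p) \<in> borel \<rightarrow>\<^sub>M count_space UNIV"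
    proof (rule measurable_Least)
      fix n
      have [measurable]: "(\<lambda>p. switch_cost \<X> d j l1 l2 (fst p) (snd p)) \<in> borel_measurable borel"
        "(\<lambda>p. ?c p (t n)) \<in> borel_measurable borel"
        by (intro borel_measurable_continuous_onI continuous_switch_cost continuous_intros)+
      show "Measurable.pred borel (?Q n)" by measurable
    qed
    then show "h \<in> borel \<rightarrow>\<^sub>M borel"
      unfolding h_def by (rule measurable_compose) simp
    show "h p \<in> \<X>" "d (h p) = j" for p using tT T(2) by (auto simp: h_def)
    show "?c p (h p) \<le> switch_cost \<X> d j l1 l2 (fst p) (snd p) + e" for p
      using LeastI_ex[OF ex[of p]] unfolding h_def .
  qed
qed

end

subsection \<open>Weak duality\<close>

lemma integral_marginal:
  fixes f :: "'b \<Rightarrow> real"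
  assumes "distr R P g = P" "g \<in> R \<rightarrow>\<^sub>M P" "integrable P f"
  shows "integrable R (\<lambda>z. f (g z))" "(\<integral>z. f (g z) \<partial>R) = (\<integral>x. f x \<partial>P)"
proof -
  show "integrable R (\<lambda>z. f (g z))"
    using assms(1,3) by (intro integrable_distr[OF assms(2)]) simp
  show "(\<integral>z. f (g z) \<partial>R) = (\<integral>x. f x \<partial>P)"
    using integral_distr[OF assms(2) borel_measurable_integrable[OF assms(3)]] assms(1) by simp
qed

lemma distr_marginal_trans:
  assumes "distr R P g = P" "g \<in> R \<rightarrow>\<^sub>M P" "distr P N h = D" "h \<in> P \<rightarrow>\<^sub>M N"
  shows "distr R N (\<lambda>z. h (g z)) = D"
  using distr_distr[OF assms(4,2)] assms(1,3) by (simp add: comp_def)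

text \<open>The class of a point is the first index of a dense sequence at distance less than
  \<open>e / 2\<close>, so two points of one class lie within \<open>e\<close> of each
  other.\<close>

lemma small_classes:
  assumes e: "0 < e"
  obtains K :: "'a::euclidean_space \<Rightarrow> nat"
  where "K \<in> borel \<rightarrow>\<^sub>M count_space UNIV" "\<And>x y. K x = K y \<Longrightarrow> dist x y < e"
proof -
  obtain T :: "'a set" where T: "countable T" "UNIV \<subseteq> closure T" using separable[of UNIV] by metis
  have Tne: "T \<noteq> {}" using T(2) by auto
  define t where "t = from_nat_into T"
  define K where "K = (\<lambda>x. LEAST n. dist x (t n) < e / 2)"
  have ex: "\<exists>n. dist x (t n) < e / 2" for x
  proof -
    have "0 < e / 2" using e by simp
    then obtain y where y: "y \<in> T" "dist y x < e / 2" using T(2) closure_approachable by blast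
    obtain n where "y = t n" using y(1) T(1) from_nat_into_surj[of T y] unfolding t_def by auto
    then show ?thesis using y(2) by (auto simp: dist_commute)
  qed
  show thesis
  proof
    show "K \<in> borel \<rightarrow>\<^sub>M count_space UNIV" unfolding K_def by (rule measurable_Least) measurable
    fix x y assume "K x = K y"
    moreover have "dist x (t (K x)) < e / 2" "dist y (t (K y)) < e / 2"
      using LeastI_ex[OF ex] by (auto simp: K_def)
    ultimately show "dist x y < e"
      using dist_triangle_half_l[of x "t (K x)" e y] by (simp add: dist_commute)
  qed
qed

text \<open>The slack \<open>e\<close> is there because the infimum need not be attained. The last
  conclusion comes from bounding the target outcome by the source outcome plus the cost. It makes
  welfare an honest integral for every law in the ambiguity set, although no moment condition is
  imposed there.\<close>

lemma cheap_coupling: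
  assumes m: "sets m = sets (borel_on A)" "integrable m fst"
    and g: "sets g = sets (borel_on B)"
    and c: "transport_cost cost_marg m g \<le> ennreal \<delta>" and \<delta>: "0 \<le> \<delta>" and e: "0 < e"
  obtains \<pi> where "\<pi> \<in> couplings m g" "integrable \<pi> (\<lambda>z. cost_marg (fst z) (snd z))"
    "(\<integral>z. cost_marg (fst z) (snd z) \<partial>\<pi>) \<le> \<delta> + e" "integrable \<pi> (\<lambda>z. fst (snd z))"
proof -
  have "ennreal \<delta> < ennreal (\<delta> + e)" using \<delta> e by (simp add: ennreal_less_iff)
  then have "transport_cost cost_marg m g < ennreal (\<delta> + e)" using c by (rule le_less_trans[rotated])
  then obtain \<pi> where \<pi>: "\<pi> \<in> couplings m g"
    and lt: "(\<integral>\<^sup>+ (s, s'). ennreal (cost_marg s s') \<partial>\<pi>) < ennreal (\<delta> + e)"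
    unfolding transport_cost_def by (auto simp: INF_less_iff)
  have s: "sets \<pi> = sets (m \<Otimes>\<^sub>M g)" and d: "distr \<pi> m fst = m" using \<pi> by (auto simp: couplings_def)
  have f: "fst \<in> \<pi> \<rightarrow>\<^sub>M m" by (simp add: measurable_cong_sets[OF s refl])
  have cm: "(\<lambda>z. cost_marg (fst z) (snd z)) \<in> borel_measurable \<pi>"
    using cost_marg_measurable[OF m(1) g] by (simp add: measurable_cong_sets[OF s refl] case_prod_unfold)
  have i: "integrable \<pi> (\<lambda>z. cost_marg (fst z) (snd z))"
    using lt cm by (intro integrableI_bounded) (auto simp: case_prod_unfold cost_marg_nonneg intro: less_trans[OF _ ennreal_less_top])
  have "ennreal (\<integral>z. cost_marg (fst z) (snd z) \<partial>\<pi>) < ennreal (\<delta> + e)"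
    using lt nn_integral_eq_integral[OF i] by (simp add: case_prod_unfold cost_marg_nonneg)
  then have le: "(\<integral>z. cost_marg (fst z) (snd z) \<partial>\<pi>) \<le> \<delta> + e"
    by (simp add: ennreal_less_iff cost_marg_nonneg)
  have "(\<lambda>z. fst (snd z)) \<in> borel_measurable \<pi>"
    unfolding measurable_cong_sets[OF s refl]
    by (rule borel_measurable_pair_borel_on[OF _ m(1) g]) (intro continuous_intros)
  then have "integrable \<pi> (\<lambda>z. fst (snd z))"
  proof (rule Bochner_Integration.integrable_bound[OF Bochner_Integration.integrable_add[OF
          integrable_abs[OF integral_marginal(1)[OF d f m(2)]] i]], intro AE_I2)
    fix z
    have "\<bar>fst (snd z)\<bar> \<le> \<bar>fst (fst z)\<bar> + cost_marg (fst z) (snd z)"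
      using norm_ge_zero[of "snd (fst z) - snd (snd z)"] unfolding cost_marg_def case_prod_unfold by linarith
    then show "norm (fst (snd z)) \<le> norm (\<bar>fst (fst z)\<bar> + cost_marg (fst z) (snd z))" by simp
  qed
  then show thesis using that \<pi> i le by blast
qed

section \<open>The dual integrand and the lower bound for fixed multipliers\<close>

locale outcome_marginals =
  fixes \<Y>1 \<Y>2 :: "real set" and \<X> :: "(real ^ 'q) set"
    and \<mu> \<nu> :: "(real \<times> (real ^ 'q)) measure" and d :: "real ^ 'q \<Rightarrow> real"
  assumes prob_mu: "prob_space \<mu>" and sets_mu: "sets \<mu> = sets (borel_on (\<Y>1 \<times> \<X>))"
    and prob_nu: "prob_space \<nu>" and sets_nu: "sets \<nu> = sets (borel_on (\<Y>2 \<times> \<X>))"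
    and int_mu: "integrable \<mu> fst" "integrable \<mu> (\<lambda>s. norm (snd s))"
    and int_nu: "integrable \<nu> fst" "integrable \<nu> (\<lambda>s. norm (snd s))"
    and d_meas: "d \<in> borel_measurable (borel_on \<X>)" and d_range: "x \<in> \<X> \<Longrightarrow> d x = 0 \<or> d x = 1"
    and level0: "\<exists>x\<in>\<X>. d x = 0" and level1: "\<exists>x\<in>\<X>. d x = 1"
begin

text \<open>The least penalised payoff starting from two sources: the outcomes stay, and both
  covariates are moved to one common point, either in level 1, where the payoff is
  \<open>y2\<close>, or in level 0, where it is \<open>y1\<close>.\<close>

definition gain :: "real \<Rightarrow> real \<Rightarrow> (real \<times> (real ^ 'q)) \<times> (real \<times> (real ^ 'q)) \<Rightarrow> real" where
  "gain l1 l2 = (\<lambda>((y1, x1), (y2, x2)).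
     min (y2 + switch_cost \<X> d 1 l1 l2 x1 x2) (y1 + switch_cost \<X> d 0 l1 l2 x1 x2))"

text \<open>Weak duality at a single target. Lowering the outcome that counts at \<open>x'\<close>
  by one unit saves one unit of payoff and costs at least one unit, because the multipliers are at
  least 1. So such a move does not pay, and what remains is the switching cost into the level set of
  \<open>x'\<close>.\<close>

lemma gain_le:
  assumes l: "1 \<le> l1" "1 \<le> l2" and x': "x' \<in> \<X>"
  shows "gain l1 l2 (s1, s2)
    \<le> y1 * (1 - d x') + y2 * d x' + l1 * cost_marg s1 (y1, x') + l2 * cost_marg s2 (y2, x')"
proof -
  have a: "fst s1 - y1 \<le> l1 * \<bar>fst s1 - y1\<bar>" "fst s2 - y2 \<le> l2 * \<bar>fst s2 - y2\<bar>"
    using l mult_right_mono[of 1 l1 "\<bar>fst s1 - y1\<bar>"] mult_right_mono[of 1 l2 "\<bar>fst s2 - y2\<bar>"] by auto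
  have nn: "0 \<le> l1 * \<bar>fst s1 - y1\<bar>" "0 \<le> l2 * \<bar>fst s2 - y2\<bar>" using l by auto
  note sw = switch_cost_le[where ?x1.0 = "snd s1" and ?x2.0 = "snd s2" and ?l1.0 = l1 and ?l2.0 = l2 and x' = x' and d = d]
  have c: "l1 * cost_marg s1 (y1, x') = l1 * \<bar>fst s1 - y1\<bar> + l1 * norm (snd s1 - x')"
    "l2 * cost_marg s2 (y2, x') = l2 * \<bar>fst s2 - y2\<bar> + l2 * norm (snd s2 - x')"
    by (simp_all add: cost_marg_def case_prod_unfold distrib_left)
  have g: "gain l1 l2 (s1, s2) \<le> fst s1 + switch_cost \<X> d 0 l1 l2 (snd s1) (snd s2)"
    "gain l1 l2 (s1, s2) \<le> fst s2 + switch_cost \<X> d 1 l1 l2 (snd s1) (snd s2)"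
    by (simp_all add: gain_def case_prod_unfold)
  have l0: "0 \<le> l1" "0 \<le> l2" using l by auto
  from d_range[OF x'] show ?thesis
  proof
    assume d: "d x' = 0"
    then have "y1 * (1 - d x') + y2 * d x' = y1" by simp
    with sw[OF level0 l0 x' d] a nn c g show ?thesis by linarith
  next
    assume d: "d x' = 1"
    then have "y1 * (1 - d x') + y2 * d x' = y2" by simp
    with sw[OF level1 l0 x' d] a nn c g show ?thesis by linarith
  qed
qed

lemma gain_measurable:
  assumes l: "0 \<le> l1" "0 \<le> l2"
  shows "gain l1 l2 \<in> borel_measurable (\<mu> \<Otimes>\<^sub>M \<nu>)"
proof (rule borel_measurable_pair_borel_on[OF _ sets_mu sets_nu])
  have "continuous_on UNIV (\<lambda>v :: (real \<times> (real ^ 'q)) \<times> (real \<times> (real ^ 'q)).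
      switch_cost \<X> d j l1 l2 (snd (fst v)) (snd (snd v)))" if "\<exists>x\<in>\<X>. d x = j" for j
    using continuous_on_compose2[OF continuous_switch_cost[OF that l], of UNIV
        "\<lambda>v :: (real \<times> (real ^ 'q)) \<times> (real \<times> (real ^ 'q)). (snd (fst v), snd (snd v))"]
    by (simp add: continuous_on_Pair continuous_on_fst continuous_on_snd continuous_on_id)
  from this[OF level0] this[OF level1] show "continuous_on UNIV (gain l1 l2)"
    unfolding gain_def case_prod_unfold by (intro continuous_intros)
qed

lemma coupling_measurable:
  assumes "\<pi> \<in> couplings \<mu> \<nu>"
  shows "fst \<in> \<pi> \<rightarrow>\<^sub>M \<mu>" "snd \<in> \<pi> \<rightarrow>\<^sub>M \<nu>"
proof -
  have s: "sets \<pi> = sets (\<mu> \<Otimes>\<^sub>M \<nu>)" using assms by (simp add: couplings_def)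
  show "fst \<in> \<pi> \<rightarrow>\<^sub>M \<mu>" "snd \<in> \<pi> \<rightarrow>\<^sub>M \<nu>" by (simp_all add: measurable_cong_sets[OF s refl])
qed

lemma switch_cost_integrable:
  assumes \<pi>: "\<pi> \<in> couplings \<mu> \<nu>" and l: "0 \<le> l1" "0 \<le> l2"
  shows "integrable \<pi> (\<lambda>v. l1 * norm (snd (fst v) - z) + l2 * norm (snd (snd v) - z))"
proof -
  interpret \<pi>: prob_space \<pi> using \<pi> by (simp add: couplings_def)
  have s: "sets \<pi> = sets (\<mu> \<Otimes>\<^sub>M \<nu>)" and d: "distr \<pi> \<mu> fst = \<mu>" "distr \<pi> \<nu> snd = \<nu>"
    using \<pi> by (auto simp: couplings_def)
  note i = integral_marginal(1)[OF d(1) coupling_measurable(1)[OF \<pi>] int_mu(2)]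
    integral_marginal(1)[OF d(2) coupling_measurable(2)[OF \<pi>] int_nu(2)]
  have b: "integrable \<pi> (\<lambda>v. l1 * (norm (snd (fst v)) + norm z) + l2 * (norm (snd (snd v)) + norm z))"
    by (intro Bochner_Integration.integrable_add integrable_mult_right i \<pi>.integrable_const)
  have "(\<lambda>v. l1 * norm (snd (fst v) - z) + l2 * norm (snd (snd v) - z)) \<in> borel_measurable \<pi>"
    unfolding measurable_cong_sets[OF s refl]
    by (rule borel_measurable_pair_borel_on[OF _ sets_mu sets_nu]) (intro continuous_intros)
  then show ?thesis
    by (rule Bochner_Integration.integrable_bound[OF b])
      (use l in \<open>auto intro!: add_mono mult_left_mono norm_triangle_ineq4\<close>)
qed

text \<open>Each switching cost is at most the cost of travelling to one fixed point of the level
  set, which grows linearly in the covariates.\<close>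

lemma gain_integrable:
  assumes \<pi>: "\<pi> \<in> couplings \<mu> \<nu>" and l: "0 \<le> l1" "0 \<le> l2"
  shows "integrable \<pi> (gain l1 l2)"
proof -
  have s: "sets \<pi> = sets (\<mu> \<Otimes>\<^sub>M \<nu>)" and d: "distr \<pi> \<mu> fst = \<mu>" "distr \<pi> \<nu> snd = \<nu>"
    using \<pi> by (auto simp: couplings_def)
  obtain z0 z1 where z: "z0 \<in> \<X>" "d z0 = 0" "z1 \<in> \<X>" "d z1 = 1" using level0 level1 by auto
  let ?c = "\<lambda>z v. l1 * norm (snd (fst v) - z) + l2 * norm (snd (snd v) - z)"
  let ?b = "\<lambda>v. (\<bar>fst (fst v)\<bar> + \<bar>fst (snd v)\<bar>) + (?c z0 v + ?c z1 v)"
  have b: "integrable \<pi> ?b"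
    by (intro Bochner_Integration.integrable_add switch_cost_integrable[OF \<pi> l] integrable_abs
      integral_marginal(1)[OF d(1) coupling_measurable(1)[OF \<pi>] int_mu(1)]
      integral_marginal(1)[OF d(2) coupling_measurable(2)[OF \<pi>] int_nu(1)])
  have "gain l1 l2 \<in> borel_measurable \<pi>"
    using gain_measurable[OF l] by (simp add: measurable_cong_sets[OF s refl])
  then show ?thesis
  proof (rule Bochner_Integration.integrable_bound[OF b], intro AE_I2)
    fix v
    show "norm (gain l1 l2 v) \<le> norm (?b v)"
      using switch_cost_le[OF level0 l z(1,2), of "snd (fst v)" "snd (snd v)"]
        switch_cost_nonneg[OF level0 l, of "snd (fst v)" "snd (snd v)"]
        switch_cost_le[OF level1 l z(3,4), of "snd (fst v)" "snd (snd v)"]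
        switch_cost_nonneg[OF level1 l, of "snd (fst v)" "snd (snd v)"]
      by (auto simp: gain_def case_prod_unfold min_def abs_if split: if_splits)
  qed
qed

text \<open>The errors have two sources: \<open>\<delta>1 + e\<close> and
  \<open>\<delta>2 + e\<close> come from near-optimal transports of the two margins, and the last
  \<open>l2 * e\<close> from the glued covariates agreeing only up to \<open>e\<close>.\<close>

lemma dual_value_le_welfare:
  assumes \<gamma>: "\<gamma> \<in> ambiguity_set \<Y>1 \<Y>2 \<X> \<mu> \<nu> \<delta>1 \<delta>2"
    and \<delta>: "0 \<le> \<delta>1" "0 \<le> \<delta>2" and l: "1 \<le> l1" "1 \<le> l2" and e: "0 < e"
  shows "\<exists>\<pi>\<in>couplings \<mu> \<nu>. (\<integral>v. gain l1 l2 v \<partial>\<pi>)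
    \<le> welfare d \<gamma> + l1 * (\<delta>1 + e) + l2 * (\<delta>2 + e) + l2 * e"
proof -
  let ?p = "\<lambda>(y1 :: real, y2 :: real, x :: real ^ 'q). (y1, x)"
  let ?q = "\<lambda>(y1 :: real, y2 :: real, x :: real ^ 'q). (y2, x)"
  define g1 where "g1 = distr \<gamma> (borel_on (\<Y>1 \<times> \<X>)) ?p"
  define g2 where "g2 = distr \<gamma> (borel_on (\<Y>2 \<times> \<X>)) ?q"
  have pg: "prob_space \<gamma>" and sg: "sets \<gamma> = sets (borel_on (\<Y>1 \<times> \<Y>2 \<times> \<X>))"
    and t1: "transport_cost cost_marg \<mu> g1 \<le> ennreal \<delta>1" and t2: "transport_cost cost_marg \<nu> g2 \<le> ennreal \<delta>2"
    using \<gamma> by (auto simp: ambiguity_set_def prob_measures_on_def g1_def g2_def)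
  have p: "?p \<in> \<gamma> \<rightarrow>\<^sub>M borel_on (\<Y>1 \<times> \<X>)" and q: "?q \<in> \<gamma> \<rightarrow>\<^sub>M borel_on (\<Y>2 \<times> \<X>)"
    by (rule measurable_into_borel_on[OF measurable_borel_on[OF _ sg]];
      auto simp: case_prod_unfold space_borel_on[OF sg] intro!: borel_measurable_continuous_onI continuous_intros)+
  have s1: "sets g1 = sets (borel_on (\<Y>1 \<times> \<X>))" and s2: "sets g2 = sets (borel_on (\<Y>2 \<times> \<X>))"
    by (simp_all add: g1_def g2_def)
  note sp1 = space_borel_on[OF s1] and sp2 = space_borel_on[OF s2]
  obtain P where P: "P \<in> couplings \<mu> g1" "integrable P (\<lambda>z. cost_marg (fst z) (snd z))"
    "(\<integral>z. cost_marg (fst z) (snd z) \<partial>P) \<le> \<delta>1 + e" "integrable P (\<lambda>z. fst (snd z))"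
    using cheap_coupling[OF sets_mu int_mu(1) s1 t1 \<delta>(1) e] .
  obtain Q where Q: "Q \<in> couplings \<nu> g2" "integrable Q (\<lambda>z. cost_marg (fst z) (snd z))"
    "(\<integral>z. cost_marg (fst z) (snd z) \<partial>Q) \<le> \<delta>2 + e" "integrable Q (\<lambda>z. fst (snd z))"
    using cheap_coupling[OF sets_nu int_nu(1) s2 t2 \<delta>(2) e] .
  have pP: "prob_space P" and sP: "sets P = sets (\<mu> \<Otimes>\<^sub>M g1)" and dP: "distr P \<mu> fst = \<mu>" "distr P g1 snd = g1"
    and pQ: "prob_space Q" and sQ: "sets Q = sets (\<nu> \<Otimes>\<^sub>M g2)" and dQ: "distr Q \<nu> fst = \<nu>" "distr Q g2 snd = g2"
    using P(1) Q(1) by (auto simp: couplings_def)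
  have mP: "fst \<in> P \<rightarrow>\<^sub>M \<mu>" "snd \<in> P \<rightarrow>\<^sub>M g1" and mQ: "fst \<in> Q \<rightarrow>\<^sub>M \<nu>" "snd \<in> Q \<rightarrow>\<^sub>M g2"
    by (simp_all add: measurable_cong_sets[OF sP refl] measurable_cong_sets[OF sQ refl])
  obtain K0 :: "real ^ 'q \<Rightarrow> nat" where K0: "K0 \<in> borel \<rightarrow>\<^sub>M count_space UNIV" "\<And>x y. K0 x = K0 y \<Longrightarrow> dist x y < e"
    using small_classes[OF e] by blast
  \<comment> \<open>A class records the value of \<open>d\<close> besides a small cell, since nearby
    covariates may lie in different level sets.\<close>
  define K where "K = (\<lambda>x. (K0 x, d x = 1))"
  have Km: "K \<in> borel_on \<X> \<rightarrow>\<^sub>M count_space UNIV"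
  proof -
    have "K0 \<in> borel_on \<X> \<rightarrow>\<^sub>M count_space UNIV" by (rule measurable_restrict_space1[OF K0(1)])
    moreover have "(\<lambda>x. d x = 1) \<in> borel_on \<X> \<rightarrow>\<^sub>M count_space UNIV" using d_meas by measurable
    ultimately have "K \<in> borel_on \<X> \<rightarrow>\<^sub>M count_space UNIV \<Otimes>\<^sub>M count_space UNIV"
      unfolding K_def by (rule measurable_Pair)
    then show ?thesis by (simp add: pair_measure_countable)
  qed
  have sn: "snd \<in> borel_on (A \<times> \<X>) \<rightarrow>\<^sub>M borel_on \<X>" for A :: "real set"
    by (rule measurable_into_borel_on[OF measurable_borel_on[OF _ refl] _ refl])
      (auto simp: space_restrict_space intro!: borel_measurable_continuous_onI continuous_intros)
  have K1: "(\<lambda>s. K (snd s)) \<in> g1 \<rightarrow>\<^sub>M count_space UNIV" and K2: "(\<lambda>s. K (snd s)) \<in> g2 \<rightarrow>\<^sub>M count_space UNIV"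
    unfolding measurable_cong_sets[OF s1 refl] measurable_cong_sets[OF s2 refl]
    by (rule measurable_compose[OF sn Km])+
  note KP = measurable_compose[OF mP(2) K1] and KQ = measurable_compose[OF mQ(2) K2]
  \<comment> \<open>Both transports end in projections of the same \<open>\<gamma>\<close>, which
    share its covariate. Hence the covariate classes at the two targets have equal laws and can be
    glued.\<close>
  have "distr P (count_space UNIV) (\<lambda>z. K (snd (snd z))) = distr g1 (count_space UNIV) (\<lambda>s. K (snd s))"
    by (rule distr_marginal_trans[OF dP(2) mP(2) refl K1])
  also have "\<dots> = distr \<gamma> (count_space UNIV) (\<lambda>(y1, y2, x). K x)"
    unfolding g1_def by (subst distr_distr[OF measurable_compose[OF sn Km] p]) (simp add: comp_def case_prod_unfold)
  also have "\<dots> = distr g2 (count_space UNIV) (\<lambda>s. K (snd s))"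
    unfolding g2_def by (subst distr_distr[OF measurable_compose[OF sn Km] q]) (simp add: comp_def case_prod_unfold)
  also have "\<dots> = distr Q (count_space UNIV) (\<lambda>z. K (snd (snd z)))"
    by (rule distr_marginal_trans[OF dQ(2) mQ(2) refl K2, symmetric])
  finally obtain R where pR: "prob_space R" and sR: "sets R = sets (P \<Otimes>\<^sub>M Q)"
    and dR: "distr R P fst = P" "distr R Q snd = Q"
    and aeR: "AE z in R. K (snd (snd (fst z))) = K (snd (snd (snd z)))"
    using glue_along_classes[OF pP pQ KP KQ] by blast
  have mR: "fst \<in> R \<rightarrow>\<^sub>M P" "snd \<in> R \<rightarrow>\<^sub>M Q" by (simp_all add: measurable_cong_sets[OF sR refl])
  interpret R: prob_space R by fact
  let ?h = "\<lambda>z. (fst (fst z), fst (snd z))"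
  have h: "?h \<in> R \<rightarrow>\<^sub>M \<mu> \<Otimes>\<^sub>M \<nu>"
    by (intro measurable_Pair measurable_compose[OF mR(1) mP(1)] measurable_compose[OF mR(2) mQ(1)])
  \<comment> \<open>The coupling to be compared with the dual consists of the sources of the two
    glued transports.\<close>
  define \<pi> where "\<pi> = distr R (\<mu> \<Otimes>\<^sub>M \<nu>) ?h"
  have \<pi>: "\<pi> \<in> couplings \<mu> \<nu>"
  proof -
    have "distr \<pi> \<mu> fst = \<mu>"
      unfolding \<pi>_def by (subst distr_distr[OF measurable_fst h])
        (simp add: comp_def distr_marginal_trans[OF dR(1) mR(1) dP(1) mP(1)])
    moreover have "distr \<pi> \<nu> snd = \<nu>"
      unfolding \<pi>_def by (subst distr_distr[OF measurable_snd h])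
        (simp add: comp_def distr_marginal_trans[OF dR(2) mR(2) dQ(1) mQ(1)])
    ultimately show ?thesis by (simp add: couplings_def \<pi>_def R.prob_space_distr[OF h])
  qed
  have l0: "0 \<le> l1" "0 \<le> l2" using l by auto
  let ?a = "\<lambda>s :: real \<times> (real ^ 'q). fst s * (1 - d (snd s))"
  let ?b = "\<lambda>s :: real \<times> (real ^ 'q). fst s * d (snd s)"
  have fm: "fst \<in> borel_on A \<rightarrow>\<^sub>M (borel :: real measure)" for A :: "(real \<times> (real ^ 'q)) set"
    by (rule measurable_borel_on[OF _ refl]) (intro borel_measurable_continuous_onI continuous_intros)
  have ma: "?a \<in> borel_measurable g1" and mb: "?b \<in> borel_measurable g2"
    unfolding measurable_cong_sets[OF s1 refl] measurable_cong_sets[OF s2 refl]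
    using measurable_compose[OF sn d_meas] fm by measurable
  have ig: "integrable g1 fst" "integrable g2 fst"
    using P(4) Q(4) integrable_distr_eq[OF mP(2), of fst] integrable_distr_eq[OF mQ(2), of fst] fm dP dQ
    by (simp_all add: measurable_cong_sets[OF s1 refl] measurable_cong_sets[OF s2 refl])
  have iA: "integrable g1 ?a"
    by (rule Bochner_Integration.integrable_bound[OF ig(1) ma]) (rule AE_I2, use d_range in \<open>force simp: sp1\<close>)
  have iB: "integrable g2 ?b"
    by (rule Bochner_Integration.integrable_bound[OF ig(2) mb]) (rule AE_I2, use d_range in \<open>force simp: sp2\<close>)
  \<comment> \<open>Each summand involves one outcome and the covariate, so welfare depends on
    \<open>\<gamma>\<close> only through its two projections. This is why a gluing that does not
    recover the joint law of the outcomes is enough.\<close>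
  have W: "welfare d \<gamma> = (\<integral>s. ?a s \<partial>g1) + (\<integral>s. ?b s \<partial>g2)"
  proof -
    have "integrable \<gamma> (\<lambda>z. ?a (?p z))" "(\<integral>z. ?a (?p z) \<partial>\<gamma>) = (\<integral>s. ?a s \<partial>g1)"
      using iA integrable_distr[OF p, of ?a] integral_distr[OF p, of ?a] ma
      by (simp_all add: g1_def measurable_cong_sets[OF s1[unfolded g1_def] refl])
    moreover have "integrable \<gamma> (\<lambda>z. ?b (?q z))" "(\<integral>z. ?b (?q z) \<partial>\<gamma>) = (\<integral>s. ?b s \<partial>g2)"
      using iB integrable_distr[OF q, of ?b] integral_distr[OF q, of ?b] mb
      by (simp_all add: g2_def measurable_cong_sets[OF s2[unfolded g2_def] refl])
    ultimately show ?thesis by (simp add: welfare_def case_prod_unfold)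
  qed
  note A = integral_marginal[OF dP(2) mP(2) iA] and B = integral_marginal[OF dQ(2) mQ(2) iB]
  note RA = integral_marginal[OF dR(1) mR(1) A(1)] and RB = integral_marginal[OF dR(2) mR(2) B(1)]
    and RP = integral_marginal[OF dR(1) mR(1) P(2)] and RQ = integral_marginal[OF dR(2) mR(2) Q(2)]
  let ?F = "\<lambda>z. ?a (snd (fst z)) + ?b (snd (snd z)) + l1 * cost_marg (fst (fst z)) (snd (fst z))
     + l2 * cost_marg (fst (snd z)) (snd (snd z)) + l2 * e"
  have iF: "integrable R ?F"
    by (intro Bochner_Integration.integrable_add RA(1) RB(1) integrable_mult_right RP(1) RQ(1) R.integrable_const)
  have "(\<integral>v. gain l1 l2 v \<partial>\<pi>) = (\<integral>z. gain l1 l2 (?h z) \<partial>R)"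
    unfolding \<pi>_def by (rule integral_distr[OF h gain_measurable[OF l0]])
  also have "\<dots> \<le> (\<integral>z. ?F z \<partial>R)"
  proof (rule integral_mono_AE[OF _ iF])
    show "integrable R (\<lambda>z. gain l1 l2 (?h z))"
      using gain_integrable[OF \<pi> l0] unfolding \<pi>_def by (rule integrable_distr[OF h])
    from aeR AE_space show "AE z in R. gain l1 l2 (?h z) \<le> ?F z"
    proof eventually_elim
      case (elim z)
      define y1 x1 y2 x2 where "y1 = fst (snd (fst z))" and "x1 = snd (snd (fst z))"
        and "y2 = fst (snd (snd z))" and "x2 = snd (snd (snd z))"
      have z: "snd (fst z) = (y1, x1)" "snd (snd z) = (y2, x2)" by (simp_all add: y1_def x1_def y2_def x2_def)
      have X: "x1 \<in> \<X>" "x2 \<in> \<X>"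
        using measurable_space[OF measurable_compose[OF mR(1) mP(2)] elim(2)]
          measurable_space[OF measurable_compose[OF mR(2) mQ(2)] elim(2)] by (auto simp: sp1 sp2 z)
      have "K x1 = K x2" using elim(1) by (simp add: z)
      then have de: "d x1 = d x2" and dist: "norm (x1 - x2) \<le> e"
        using d_range[OF X(1)] d_range[OF X(2)] K0(2)[of x1 x2] by (auto simp: K_def dist_norm)
      \<comment> \<open>A single target is required, but the transports end at \<open>x1\<close> and
        \<open>x2\<close>. The second one is redirected to \<open>x1\<close>: the payoff is
        unchanged because \<open>d x1 = d x2\<close>, and the extra distance is at most
        \<open>e\<close>.\<close>
      have "gain l1 l2 (?h z) \<le> y1 * (1 - d x1) + y2 * d x1 + l1 * cost_marg (fst (fst z)) (y1, x1)
          + l2 * cost_marg (fst (snd z)) (y2, x1)"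
        by (rule gain_le[OF l X(1)])
      also have "cost_marg (fst (snd z)) (y2, x1) \<le> cost_marg (fst (snd z)) (y2, x2) + e"
        using norm_triangle_ineq[of "snd (fst (snd z)) - x2" "x2 - x1"] dist
        by (simp add: cost_marg_def case_prod_unfold norm_minus_commute)
      then have "l2 * cost_marg (fst (snd z)) (y2, x1) \<le> l2 * cost_marg (fst (snd z)) (y2, x2) + l2 * e"
        using l0(2) by (simp flip: distrib_left add: mult_left_mono)
      finally show ?case by (simp add: z de)
    qed
  qed
  also have "\<dots> = welfare d \<gamma> + l1 * (\<integral>z. cost_marg (fst z) (snd z) \<partial>P)
      + l2 * (\<integral>z. cost_marg (fst z) (snd z) \<partial>Q) + l2 * e"
    using RA RB RP RQ A(2) B(2) W by (simp add: R.prob_space)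
  also have "\<dots> \<le> welfare d \<gamma> + l1 * (\<delta>1 + e) + l2 * (\<delta>2 + e) + l2 * e"
    using l0 P(3) Q(3) by (intro add_mono mult_left_mono order_refl)
  finally show ?thesis using \<pi> by blast
qed

lemma dual_welfare_eq:
  "dual_welfare \<X> d \<mu> \<nu> \<delta>1 \<delta>2 = (SUP (l1, l2) \<in> {1..} \<times> {1..}.
     (INF \<pi>\<in>couplings \<mu> \<nu>. ereal (\<integral>v. gain l1 l2 v \<partial>\<pi>)) - ereal (l1 * \<delta>1 + l2 * \<delta>2))"
  by (simp add: dual_welfare_def gain_def)

lemma weak_duality:
  assumes \<delta>: "0 \<le> \<delta>1" "0 \<le> \<delta>2"
  shows "dual_welfare \<X> d \<mu> \<nu> \<delta>1 \<delta>2 \<le> robust_welfare d (ambiguity_set \<Y>1 \<Y>2 \<X> \<mu> \<nu> \<delta>1 \<delta>2)"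
  unfolding dual_welfare_eq robust_welfare_def
proof (rule SUP_least, rule INF_greatest, clarify)
  fix \<gamma> and l1 l2 :: real
  assume \<gamma>: "\<gamma> \<in> ambiguity_set \<Y>1 \<Y>2 \<X> \<mu> \<nu> \<delta>1 \<delta>2" and "1 \<le> l1" "1 \<le> l2"
  then have l: "1 \<le> l1" "1 \<le> l2" by auto
  let ?I = "INF \<pi>\<in>couplings \<mu> \<nu>. ereal (\<integral>v. gain l1 l2 v \<partial>\<pi>)"
  have "?I \<le> ereal (welfare d \<gamma> + (l1 * \<delta>1 + l2 * \<delta>2))"
  proof (rule ereal_le_epsilon2)
    fix e :: real assume e: "0 < e"
    \<comment> \<open>The errors in \<open>dual_value_le_welfare\<close> add up to
      \<open>l1 * e' + 2 * l2 * e'\<close>, which this choice makes equal to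
      \<open>e\<close>.\<close>
    define e' where "e' = e / (l1 + 2 * l2)"
    have e': "0 < e'" "e' * (l1 + 2 * l2) = e" using e l by (auto simp: e'_def)
    obtain \<pi> where \<pi>: "\<pi> \<in> couplings \<mu> \<nu>" "(\<integral>v. gain l1 l2 v \<partial>\<pi>)
        \<le> welfare d \<gamma> + l1 * (\<delta>1 + e') + l2 * (\<delta>2 + e') + l2 * e'"
      using dual_value_le_welfare[OF \<gamma> \<delta> l e'(1)] by blast
    have "?I \<le> ereal (\<integral>v. gain l1 l2 v \<partial>\<pi>)" by (rule INF_lower[OF \<pi>(1)])
    also have "\<dots> \<le> ereal (welfare d \<gamma> + (l1 * \<delta>1 + l2 * \<delta>2)) + ereal e"
      using \<pi>(2) e'(2) by (simp add: algebra_simps)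
    finally show "?I \<le> ereal (welfare d \<gamma> + (l1 * \<delta>1 + l2 * \<delta>2)) + ereal e" .
  qed
  then show "?I - ereal (l1 * \<delta>1 + l2 * \<delta>2) \<le> ereal (welfare d \<gamma>)"
    by (cases ?I) auto
qed

end

subsection \<open>Lagrange multipliers\<close>

lemma lagrange_multipliers:
  fixes D :: "(real \<times> real \<times> real) set"
  assumes D: "convex D"
    and slater: "(a0, b0, r0) \<in> D" "a0 < \<delta>1" "b0 < \<delta>2"
    and v: "\<And>a b r. (a, b, r) \<in> D \<Longrightarrow> a \<le> \<delta>1 \<Longrightarrow> b \<le> \<delta>2 \<Longrightarrow> v \<le> r"
  obtains l1 l2 where "0 \<le> l1" "0 \<le> l2"
    "\<forall>a b r. (a, b, r) \<in> D \<longrightarrow> v \<le> r + l1 * (a - \<delta>1) + l2 * (b - \<delta>2)"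
proof -
  \<comment> \<open>Only the payoff coordinate is strict: this keeps the set disjoint from
    \<open>D\<close> even if \<open>v\<close> is attained.\<close>
  let ?T = "{..\<delta>1} \<times> {..\<delta>2} \<times> {..<v}"
  have "convex ?T" by (intro convex_Times convex_real_interval)
  moreover have "D \<inter> ?T = {}"
  proof (rule ccontr)
    assume "D \<inter> ?T \<noteq> {}"
    then obtain a b r where "(a, b, r) \<in> D" "a \<le> \<delta>1" "b \<le> \<delta>2" "r < v" by auto
    with v[of a b r] show False by simp
  qed
  moreover have "D \<noteq> {}" using slater by auto
  moreover have "?T \<noteq> {}" proof -
    have "(\<delta>1, \<delta>2, v - 1) \<in> ?T" by simp
    then show ?thesis by blast
  qed
  ultimately obtain n k where n: "n \<noteq> 0" "\<And>x. x \<in> ?T \<Longrightarrow> inner n x \<le> k" "\<And>x. x \<in> D \<Longrightarrow> k \<le> inner n x"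
    using separating_hyperplane_sets[of ?T D] D by (metis (no_types, lifting) Int_commute)
  obtain \<alpha> \<beta> \<rho> where abr: "n = (\<alpha>, \<beta>, \<rho>)" by (cases n)
  have T: "\<alpha> * a + (\<beta> * b + \<rho> * r) \<le> k" if "a \<le> \<delta>1" "b \<le> \<delta>2" "r < v" for a b r
    using n(2)[of "(a, b, r)"] that by (simp add: abr)
  have DD: "k \<le> \<alpha> * a + (\<beta> * b + \<rho> * r)" if "(a, b, r) \<in> D" for a b r
    using n(3)[OF that] by (simp add: abr)
  \<comment> \<open>\<open>?T\<close> contains a downward ray in each coordinate direction. A
    negative component of the normal would make the inner product unbounded above on such a
    ray.\<close>
  have slope: "0 \<le> c" if c: "\<And>t. 0 \<le> t \<Longrightarrow> m - c * t \<le> k" for c m :: real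
  proof (rule ccontr)
    assume "\<not> 0 \<le> c"
    then have "c < 0" by simp
    define t where "t = (\<bar>k - m\<bar> + 1) / (- c)"
    have "0 \<le> t" "- c * t = \<bar>k - m\<bar> + 1" using \<open>c < 0\<close> by (auto simp: t_def intro!: divide_nonneg_neg)
    with c[of t] show False by simp
  qed
  have a: "0 \<le> \<alpha>"
    using T[of "\<delta>1 - t" \<delta>2 "v - 1" for t] by (intro slope[of "\<alpha> * \<delta>1 + \<beta> * \<delta>2 + \<rho> * (v - 1)"]) (simp add: algebra_simps)
  have b: "0 \<le> \<beta>"
    using T[of \<delta>1 "\<delta>2 - t" "v - 1" for t] by (intro slope[of "\<alpha> * \<delta>1 + \<beta> * \<delta>2 + \<rho> * (v - 1)"]) (simp add: algebra_simps)
  have r: "0 \<le> \<rho>"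
    using T[of \<delta>1 \<delta>2 "v - 1 - t" for t] by (intro slope[of "\<alpha> * \<delta>1 + \<beta> * \<delta>2 + \<rho> * (v - 1)"]) (simp add: algebra_simps)
  \<comment> \<open>The corner with payoff \<open>v\<close> is missing from \<open>?T\<close>, so it
    is approached from below. The step \<open>e / (\<rho> + 1)\<close> changes the product by at
    most \<open>e\<close> and is well defined while \<open>\<rho> = 0\<close> is still
    possible.\<close>
  have key: "\<alpha> * \<delta>1 + (\<beta> * \<delta>2 + \<rho> * v) \<le> k"
  proof (rule field_le_epsilon)
    fix e :: real assume e: "0 < e"
    have "\<rho> * (v - e / (\<rho> + 1)) \<ge> \<rho> * v - e"
    proof -
      have "\<rho> * (e / (\<rho> + 1)) \<le> e" using r e by (simp add: field_simps)
      then show ?thesis by (simp add: right_diff_distrib)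
    qed
    moreover have "0 < e / (\<rho> + 1)" using r e by auto
    ultimately show "\<alpha> * \<delta>1 + (\<beta> * \<delta>2 + \<rho> * v) \<le> k + e"
      using T[of \<delta>1 \<delta>2 "v - e / (\<rho> + 1)"] by simp
  qed
  \<comment> \<open>This is the exclusion of a vertical hyperplane: with \<open>\<rho> = 0\<close>
    the Slater point would lie on it, and the strict inequalities would force the whole normal to
    vanish.\<close>
  have "\<rho> \<noteq> 0"
  proof
    assume z: "\<rho> = 0"
    have "\<alpha> * \<delta>1 + \<beta> * \<delta>2 \<le> \<alpha> * a0 + \<beta> * b0" using key DD[OF slater(1)] z by simp
    moreover have "\<alpha> * a0 \<le> \<alpha> * \<delta>1" "\<beta> * b0 \<le> \<beta> * \<delta>2" using a b slater by (auto intro: mult_left_mono)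
    ultimately have "\<alpha> * a0 = \<alpha> * \<delta>1" "\<beta> * b0 = \<beta> * \<delta>2" by linarith+
    then have "\<alpha> = 0" "\<beta> = 0" using slater by auto
    then show False using n(1) abr z by (simp add: zero_prod_def)
  qed
  then have r: "0 < \<rho>" using r by simp
  show thesis
  proof (rule that)
    show "0 \<le> \<alpha> / \<rho>" "0 \<le> \<beta> / \<rho>" using a b r by auto
    show "\<forall>x y z. (x, y, z) \<in> D \<longrightarrow> v \<le> z + \<alpha> / \<rho> * (x - \<delta>1) + \<beta> / \<rho> * (y - \<delta>2)"
    proof (intro allI impI)
      fix x y z assume "(x, y, z) \<in> D"
      then have "\<alpha> * \<delta>1 + (\<beta> * \<delta>2 + \<rho> * v) \<le> \<alpha> * x + (\<beta> * y + \<rho> * z)" using DD key by fastforce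
      moreover have "\<rho> * (z + \<alpha> / \<rho> * (x - \<delta>1) + \<beta> / \<rho> * (y - \<delta>2)) = \<rho> * z + \<alpha> * (x - \<delta>1) + \<beta> * (y - \<delta>2)"
        using r by (simp add: distrib_left)
      ultimately have "\<rho> * v \<le> \<rho> * (z + \<alpha> / \<rho> * (x - \<delta>1) + \<beta> / \<rho> * (y - \<delta>2))"
        by (simp add: right_diff_distrib)
      then show "v \<le> z + \<alpha> / \<rho> * (x - \<delta>1) + \<beta> / \<rho> * (y - \<delta>2)" using r by simp
    qed
  qed
qed

text \<open>Lowering the payoff \<open>r\<close> by one unit raises the bound on the cost
  \<open>a\<close> by one unit. With \<open>l < 1\<close> the penalised payoff would tend to minus
  infinity, against the lower bound \<open>v\<close>.\<close>

lemma multiplier_ge_1: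
  fixes l C v :: real
  assumes l: "0 \<le> l" and C: "\<And>N. \<exists>a r. r \<le> - N \<and> a \<le> C - r \<and> v \<le> r + l * a"
  shows "1 \<le> l"
proof (rule ccontr)
  assume "\<not> 1 \<le> l"
  then have l1: "0 < 1 - l" by simp
  \<comment> \<open>The depth is chosen so that \<open>(1 - l) * r\<close> is at most the negative
    of everything else, with 1 to spare.\<close>
  obtain a r where ar: "r \<le> - ((\<bar>v\<bar> + l * \<bar>C\<bar> + 1) / (1 - l))" "a \<le> C - r" "v \<le> r + l * a" using C by blast
  have "l * a \<le> l * (C - r)" using ar(2) l by (rule mult_left_mono)
  moreover have "l * C \<le> l * \<bar>C\<bar>" using l by (simp add: mult_left_mono)
  ultimately have "v \<le> (1 - l) * r + l * \<bar>C\<bar>" using ar(3) by (simp add: algebra_simps)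
  moreover have "(1 - l) * r \<le> - (\<bar>v\<bar> + l * \<bar>C\<bar> + 1)"
    using mult_left_mono[OF ar(1), of "1 - l"] l1 by simp
  ultimately show False by linarith
qed

subsection \<open>Transport plans and strong duality\<close>

lemma ident_measurable_pair:
  fixes A :: "'a::second_countable_topology measure" and B :: "'b::second_countable_topology measure"
  assumes "(\<lambda>x. x) \<in> A \<rightarrow>\<^sub>M borel" "(\<lambda>x. x) \<in> B \<rightarrow>\<^sub>M borel"
  shows "(\<lambda>x. x) \<in> A \<Otimes>\<^sub>M B \<rightarrow>\<^sub>M borel"
proof -
  have "(\<lambda>z. (fst z, snd z)) \<in> A \<Otimes>\<^sub>M B \<rightarrow>\<^sub>M borel \<Otimes>\<^sub>M borel"
    using measurable_compose[OF measurable_fst assms(1)] measurable_compose[OF measurable_snd assms(2)]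
    by (intro measurable_Pair)
  then show ?thesis by (simp add: borel_prod)
qed

section \<open>Plans and their attainable triples\<close>

context outcome_marginals
begin

abbreviation outcomes :: "(real \<times> real \<times> (real ^ 'q)) measure" where
  "outcomes \<equiv> borel_on (\<Y>1 \<times> \<Y>2 \<times> \<X>)"

abbreviation moves :: "(((real \<times> (real ^ 'q)) \<times> real \<times> (real ^ 'q)) \<times> (real \<times> real \<times> (real ^ 'q))) measure" where
  "moves \<equiv> (\<mu> \<Otimes>\<^sub>M \<nu>) \<Otimes>\<^sub>M outcomes"

definition cost1 :: "((real \<times> (real ^ 'q)) \<times> real \<times> (real ^ 'q)) \<times> (real \<times> real \<times> (real ^ 'q)) \<Rightarrow> real" where
  "cost1 z = cost_marg (fst (fst z)) (fst (snd z), snd (snd (snd z)))"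

definition cost2 :: "((real \<times> (real ^ 'q)) \<times> real \<times> (real ^ 'q)) \<times> (real \<times> real \<times> (real ^ 'q)) \<Rightarrow> real" where
  "cost2 z = cost_marg (snd (fst z)) (fst (snd (snd z)), snd (snd (snd z)))"

definition payoff :: "real \<times> real \<times> (real ^ 'q) \<Rightarrow> real" where
  "payoff s = fst s * (1 - d (snd (snd s))) + fst (snd s) * d (snd (snd s))"

text \<open>Only the two source margins are prescribed; their coupling is left free. Integrability
  is required because a Bochner integral defaults to 0 otherwise, which would let spurious triples
  in and break linearity under mixing.\<close>

definition plan where
  "plan Q \<longleftrightarrow> prob_space Q \<and> sets Q = sets moves \<and>
     distr Q \<mu> (\<lambda>z. fst (fst z)) = \<mu> \<and> distr Q \<nu> (\<lambda>z. snd (fst z)) = \<nu> \<and>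
     integrable Q cost1 \<and> integrable Q cost2 \<and> integrable Q (\<lambda>z. payoff (snd z))"

definition attainable :: "(real \<times> real \<times> real) set" where
  "attainable = (\<lambda>Q. (\<integral>z. cost1 z \<partial>Q, \<integral>z. cost2 z \<partial>Q, \<integral>z. payoff (snd z) \<partial>Q)) ` {Q. plan Q}"

lemma ident_outcomes: "(\<lambda>s. s) \<in> outcomes \<rightarrow>\<^sub>M borel"
  by (rule measurable_borel_on[OF measurable_ident_sets[OF refl] refl])

lemma ident_sources: "(\<lambda>s. s) \<in> \<mu> \<Otimes>\<^sub>M \<nu> \<rightarrow>\<^sub>M borel"
  by (rule ident_measurable_pair[OF measurable_borel_on[OF measurable_ident_sets[OF refl] sets_mu]
        measurable_borel_on[OF measurable_ident_sets[OF refl] sets_nu]])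

lemma ident_moves: "(\<lambda>s. s) \<in> moves \<rightarrow>\<^sub>M borel"
  by (rule ident_measurable_pair[OF ident_sources ident_outcomes])

lemma cost_measurable: "cost1 \<in> borel_measurable moves" "cost2 \<in> borel_measurable moves"
  by (rule measurable_compose[OF ident_moves, of _ borel, simplified];
      auto simp: cost1_def[abs_def] cost2_def[abs_def] cost_marg_def case_prod_unfold
        intro!: borel_measurable_continuous_onI continuous_intros)+

lemma covariate_measurable: "(\<lambda>s. snd (snd s)) \<in> outcomes \<rightarrow>\<^sub>M borel_on \<X>"
  by (rule measurable_into_borel_on[OF measurable_borel_on[OF _ refl] _ refl])
    (auto simp: space_restrict_space intro!: borel_measurable_continuous_onI continuous_intros)

lemma payoff_measurable: "payoff \<in> borel_measurable outcomes"
proof -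
  have [measurable]: "fst \<in> borel_measurable outcomes" "(\<lambda>s. fst (snd s)) \<in> borel_measurable outcomes"
    by (rule measurable_borel_on[OF _ refl]; intro borel_measurable_continuous_onI continuous_intros)+
  have [measurable]: "(\<lambda>s. d (snd (snd s))) \<in> borel_measurable outcomes"
    by (rule measurable_compose[OF covariate_measurable d_meas])
  show ?thesis unfolding payoff_def[abs_def] by measurable
qed

lemma source_measurable:
  "(\<lambda>z. fst (fst z)) \<in> moves \<rightarrow>\<^sub>M \<mu>" "(\<lambda>z. snd (fst z)) \<in> moves \<rightarrow>\<^sub>M \<nu>"
  by (rule measurable_compose[OF measurable_fst measurable_fst]
      measurable_compose[OF measurable_fst measurable_snd])+

lemma convex_attainable: "convex attainable"
proof (rule convexI)
  fix x y and u t :: real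
  assume "x \<in> attainable" "y \<in> attainable" and ut: "0 \<le> u" "0 \<le> t" "u + t = 1"
  then obtain P Q where P: "plan P" "x = (\<integral>z. cost1 z \<partial>P, \<integral>z. cost2 z \<partial>P, \<integral>z. payoff (snd z) \<partial>P)"
    and Q: "plan Q" "y = (\<integral>z. cost1 z \<partial>Q, \<integral>z. cost2 z \<partial>Q, \<integral>z. payoff (snd z) \<partial>Q)"
    by (auto simp: attainable_def)
  have u: "0 \<le> u" "u \<le> 1" and t: "t = 1 - u" using ut by auto
  have pr: "prob_space P" "prob_space Q" and s: "sets Q = sets P" and sP: "sets P = sets moves"
    using P(1) Q(1) by (auto simp: plan_def)
  note mix = integral_mix[OF u pr s]
  let ?M = "mix_measure u P Q"
  have "plan ?M"
    unfolding plan_def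
    using P(1) Q(1) source_measurable sP
    by (auto simp: plan_def prob_space_mix[OF u pr s] sets_mix[OF u pr s] measurable_cong_sets[OF sP refl]
        intro!: distr_mix[OF u pr s] mix)
  moreover have "u *\<^sub>R x + t *\<^sub>R y = (\<integral>z. cost1 z \<partial>?M, \<integral>z. cost2 z \<partial>?M, \<integral>z. payoff (snd z) \<partial>?M)"
    using P Q by (simp add: plan_def t mix(2))
  ultimately show "u *\<^sub>R x + t *\<^sub>R y \<in> attainable" by (auto simp: attainable_def)
qed

text \<open>Randomised moves serve convexity only. Every plan constructed explicitly below moves
  each pair of sources by a function.\<close>

lemma attainable_map:
  assumes \<pi>: "\<pi> \<in> couplings \<mu> \<nu>" and h: "h \<in> \<mu> \<Otimes>\<^sub>M \<nu> \<rightarrow>\<^sub>M outcomes"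
    and i: "integrable \<pi> (\<lambda>v. cost1 (v, h v))" "integrable \<pi> (\<lambda>v. cost2 (v, h v))" "integrable \<pi> (\<lambda>v. payoff (h v))"
  shows "(\<integral>v. cost1 (v, h v) \<partial>\<pi>, \<integral>v. cost2 (v, h v) \<partial>\<pi>, \<integral>v. payoff (h v) \<partial>\<pi>) \<in> attainable"
proof -
  have pr: "prob_space \<pi>" and s: "sets \<pi> = sets (\<mu> \<Otimes>\<^sub>M \<nu>)" and dd: "distr \<pi> \<mu> fst = \<mu>" "distr \<pi> \<nu> snd = \<nu>"
    using \<pi> by (auto simp: couplings_def)
  have g: "(\<lambda>v. (v, h v)) \<in> \<pi> \<rightarrow>\<^sub>M moves"
    unfolding measurable_cong_sets[OF s refl] by (intro measurable_Pair measurable_ident_sets[OF refl] h)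
  have pm: "(\<lambda>z. payoff (snd z)) \<in> borel_measurable moves"
    by (rule measurable_compose[OF measurable_snd payoff_measurable])
  let ?Q = "distr \<pi> moves (\<lambda>v. (v, h v))"
  have "plan ?Q"
    unfolding plan_def
    using i prob_space.prob_space_distr[OF pr g] dd
    by (auto simp: integrable_distr_eq[OF g] cost_measurable pm distr_distr[OF source_measurable(1) g]
        distr_distr[OF source_measurable(2) g] comp_def)
  moreover have "(\<integral>z. cost1 z \<partial>?Q) = (\<integral>v. cost1 (v, h v) \<partial>\<pi>)" "(\<integral>z. cost2 z \<partial>?Q) = (\<integral>v. cost2 (v, h v) \<partial>\<pi>)"
    "(\<integral>z. payoff (snd z) \<partial>?Q) = (\<integral>v. payoff (h v) \<partial>\<pi>)"
    by (simp_all add: integral_distr[OF g] cost_measurable pm)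
  ultimately show ?thesis by (force simp: attainable_def)
qed

text \<open>A plan holds source and target together, so its image under one source and the matching
  part of the target is a coupling for that margin, with cost the integral over the plan. Both
  margins are instances.\<close>

lemma plan_transport_cost:
  assumes Q: "plan Q"
    and m: "sets m = sets (borel_on A)" "distr Q m f = m" "f \<in> moves \<rightarrow>\<^sub>M m"
    and g: "g \<in> outcomes \<rightarrow>\<^sub>M borel_on B"
    and i: "integrable Q (\<lambda>z. cost_marg (f z) (g (snd z)))"
    and le: "(\<integral>z. cost_marg (f z) (g (snd z)) \<partial>Q) \<le> \<delta>"
  shows "transport_cost cost_marg m (distr (distr Q outcomes snd) (borel_on B) g) \<le> ennreal \<delta>"
proof -
  have pQ: "prob_space Q" and sQ: "sets Q = sets moves" using Q by (auto simp: plan_def)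
  note mQ = measurable_cong_sets[OF sQ refl]
  have sn: "snd \<in> Q \<rightarrow>\<^sub>M outcomes" by (simp add: mQ)
  have gs: "(\<lambda>z. g (snd z)) \<in> Q \<rightarrow>\<^sub>M borel_on B" by (rule measurable_compose[OF sn g])
  have fQ: "f \<in> Q \<rightarrow>\<^sub>M m" using m(3) by (simp only: mQ)
  let ?g = "distr (distr Q outcomes snd) (borel_on B) g"
  have ge: "?g = distr Q (borel_on B) (\<lambda>z. g (snd z))"
    by (subst distr_distr[OF g sn]) (simp add: comp_def)
  let ?k = "\<lambda>z. (f z, g (snd z))"
  have sp: "sets (m \<Otimes>\<^sub>M borel_on B) = sets (m \<Otimes>\<^sub>M ?g)" by (rule sets_pair_measure_cong) simp_all
  have k: "?k \<in> Q \<rightarrow>\<^sub>M m \<Otimes>\<^sub>M borel_on B" by (rule measurable_Pair[OF fQ gs])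
  let ?\<pi> = "distr Q (m \<Otimes>\<^sub>M borel_on B) ?k"
  have "distr ?\<pi> m fst = m" by (subst distr_distr[OF measurable_fst k]) (simp add: comp_def m(2))
  moreover have "distr ?\<pi> ?g snd = ?g"
  proof -
    have "distr ?\<pi> ?g snd = distr ?\<pi> (borel_on B) snd" by (rule distr_cong) auto
    also have "\<dots> = ?g" unfolding ge by (subst distr_distr[OF measurable_snd k]) (simp add: comp_def)
    finally show ?thesis .
  qed
  ultimately have "?\<pi> \<in> couplings m ?g"
    using prob_space.prob_space_distr[OF pQ k] sp by (simp add: couplings_def)
  then have "transport_cost cost_marg m ?g \<le> (\<integral>\<^sup>+ (s, s'). ennreal (cost_marg s s') \<partial>?\<pi>)"
    unfolding transport_cost_def by (rule INF_lower)
  also have "\<dots> = (\<integral>\<^sup>+ z. ennreal (cost_marg (f z) (g (snd z))) \<partial>Q)"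
    using cost_marg_measurable[OF m(1) refl, of B] by (subst nn_integral_distr[OF k]) (auto simp: case_prod_unfold)
  also have "\<dots> = ennreal (\<integral>z. cost_marg (f z) (g (snd z)) \<partial>Q)"
    by (rule nn_integral_eq_integral[OF i]) (simp add: cost_marg_nonneg)
  also have "\<dots> \<le> ennreal \<delta>" by (rule ennreal_leI[OF le])
  finally show ?thesis .
qed

lemma robust_welfare_le_attainable:
  assumes "(a, b, r) \<in> attainable" "a \<le> \<delta>1" "b \<le> \<delta>2"
  shows "robust_welfare d (ambiguity_set \<Y>1 \<Y>2 \<X> \<mu> \<nu> \<delta>1 \<delta>2) \<le> ereal r"
proof -
  obtain Q where Q: "plan Q" "a = (\<integral>z. cost1 z \<partial>Q)" "b = (\<integral>z. cost2 z \<partial>Q)" "r = (\<integral>z. payoff (snd z) \<partial>Q)"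
    using assms(1) by (auto simp: attainable_def)
  have pQ: "prob_space Q" and sQ: "sets Q = sets moves" using Q by (auto simp: plan_def)
  have sn: "snd \<in> Q \<rightarrow>\<^sub>M outcomes" by (simp add: measurable_cong_sets[OF sQ refl])
  let ?\<gamma> = "distr Q outcomes snd"
  let ?p = "\<lambda>(y1 :: real, y2 :: real, x :: real ^ 'q). (y1, x)"
  let ?q = "\<lambda>(y1 :: real, y2 :: real, x :: real ^ 'q). (y2, x)"
  have p: "?p \<in> outcomes \<rightarrow>\<^sub>M borel_on (\<Y>1 \<times> \<X>)" and q: "?q \<in> outcomes \<rightarrow>\<^sub>M borel_on (\<Y>2 \<times> \<X>)"
    by (rule measurable_into_borel_on[OF measurable_borel_on[OF _ refl]];
      auto simp: case_prod_unfold space_restrict_space intro!: borel_measurable_continuous_onI continuous_intros)+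
  have "transport_cost cost_marg \<mu> (distr ?\<gamma> (borel_on (\<Y>1 \<times> \<X>)) ?p) \<le> ennreal \<delta>1"
    using Q(1,2) assms(2)
    by (intro plan_transport_cost[OF Q(1) sets_mu _ source_measurable(1) p])
      (auto simp: plan_def cost1_def[abs_def] case_prod_unfold)
  moreover have "transport_cost cost_marg \<nu> (distr ?\<gamma> (borel_on (\<Y>2 \<times> \<X>)) ?q) \<le> ennreal \<delta>2"
    using Q(1,3) assms(3)
    by (intro plan_transport_cost[OF Q(1) sets_nu _ source_measurable(2) q])
      (auto simp: plan_def cost2_def[abs_def] case_prod_unfold)
  ultimately have "?\<gamma> \<in> ambiguity_set \<Y>1 \<Y>2 \<X> \<mu> \<nu> \<delta>1 \<delta>2"
    using prob_space.prob_space_distr[OF pQ sn] by (simp add: ambiguity_set_def prob_measures_on_def)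
  then have "robust_welfare d (ambiguity_set \<Y>1 \<Y>2 \<X> \<mu> \<nu> \<delta>1 \<delta>2) \<le> ereal (welfare d ?\<gamma>)"
    unfolding robust_welfare_def by (rule INF_lower)
  also have "welfare d ?\<gamma> = r"
    using integral_distr[OF sn payoff_measurable]
    by (simp add: welfare_def Q(4) payoff_def[abs_def] case_prod_unfold)
  finally show ?thesis .
qed

end

text \<open>What matters is that the bound grows in \<open>t\<close> with slope exactly one: this is
  the unit cost per unit of welfare that \<open>multiplier_ge_1\<close> asks for.\<close>

lemma cost_to_point:
  assumes m: "prob_space m" "sets m = sets (borel_on A)" "integrable m fst" "integrable m (\<lambda>s. norm (snd s))"
  shows "integrable m (\<lambda>s. cost_marg s (t, z))"
    and "(\<integral>s. cost_marg s (t, z) \<partial>m) \<le> (\<integral>s. \<bar>fst s\<bar> \<partial>m) + (\<integral>s. norm (snd s) \<partial>m) + \<bar>t\<bar> + norm z"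
proof -
  interpret m: prob_space m by fact
  let ?b = "\<lambda>s. (\<bar>fst s\<bar> + norm (snd s)) + (\<bar>t\<bar> + norm z)"
  have b: "integrable m ?b"
    by (intro Bochner_Integration.integrable_add integrable_abs m m.integrable_const)
  have le: "cost_marg s (t, z) \<le> ?b s" for s
    using abs_triangle_ineq4[of "fst s" t] norm_triangle_ineq4[of "snd s" z]
    by (simp add: cost_marg_def case_prod_unfold)
  have "(\<lambda>s. cost_marg s (t, z)) \<in> borel_measurable m"
    by (rule measurable_borel_on[OF _ m(2)])
      (auto simp: cost_marg_def case_prod_unfold intro!: borel_measurable_continuous_onI continuous_intros)
  then show i: "integrable m (\<lambda>s. cost_marg s (t, z))"
  proof (rule Bochner_Integration.integrable_bound[OF b], intro AE_I2)
    fix s show "norm (cost_marg s (t, z)) \<le> norm (?b s)"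
      using le[of s] cost_marg_nonneg[of s "(t, z)"] by simp
  qed
  have "(\<integral>s. cost_marg s (t, z) \<partial>m) \<le> (\<integral>s. ?b s \<partial>m)" by (rule integral_mono[OF i b le])
  also have "\<dots> = (\<integral>s. \<bar>fst s\<bar> \<partial>m) + (\<integral>s. norm (snd s) \<partial>m) + \<bar>t\<bar> + norm z"
    using m by (simp add: m.prob_space)
  finally show "(\<integral>s. cost_marg s (t, z) \<partial>m) \<le> (\<integral>s. \<bar>fst s\<bar> \<partial>m) + (\<integral>s. norm (snd s) \<partial>m) + \<bar>t\<bar> + norm z" .
qed

context outcome_marginals
begin

lemma attainable_constant:
  assumes \<pi>: "\<pi> \<in> couplings \<mu> \<nu>" and w: "t1 \<in> \<Y>1" "t2 \<in> \<Y>2" "z \<in> \<X>"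
  shows "((\<integral>s. cost_marg s (t1, z) \<partial>\<mu>), (\<integral>s. cost_marg s (t2, z) \<partial>\<nu>), t1 * (1 - d z) + t2 * d z) \<in> attainable"
proof -
  have d: "distr \<pi> \<mu> fst = \<mu>" "distr \<pi> \<nu> snd = \<nu>" and "prob_space \<pi>" using \<pi> by (auto simp: couplings_def)
  interpret \<pi>: prob_space \<pi> by fact
  note i1 = integral_marginal[OF d(1) coupling_measurable(1)[OF \<pi>] cost_to_point(1)[OF prob_mu sets_mu int_mu, of t1 z]]
  note i2 = integral_marginal[OF d(2) coupling_measurable(2)[OF \<pi>] cost_to_point(1)[OF prob_nu sets_nu int_nu, of t2 z]]
  have "(\<lambda>_. (t1, t2, z)) \<in> \<mu> \<Otimes>\<^sub>M \<nu> \<rightarrow>\<^sub>M outcomes"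
    using w by (intro measurable_const) (simp add: space_restrict_space)
  from attainable_map[OF \<pi> this] show ?thesis
    using i1 i2 by (simp add: cost1_def cost2_def payoff_def \<pi>.prob_space)
qed

text \<open>All mass is sent to one point. In level 0 the payoff is the first outcome alone, so
  sending that outcome to minus infinity with everything else fixed tests \<open>l1\<close>; a point
  of level 1 tests \<open>l2\<close> in the same way.\<close>

lemma multipliers_ge_1:
  assumes \<pi>: "\<pi> \<in> couplings \<mu> \<nu>" and Y: "\<not> bdd_below \<Y>1" "\<not> bdd_below \<Y>2"
    and l: "0 \<le> l1" "0 \<le> l2"
    and v: "\<And>a b r. (a, b, r) \<in> attainable \<Longrightarrow> v \<le> r + l1 * (a - \<delta>1) + l2 * (b - \<delta>2)"
  shows "1 \<le> l1" "1 \<le> l2"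
proof -
  obtain z0 z1 where z: "z0 \<in> \<X>" "d z0 = 0" "z1 \<in> \<X>" "d z1 = 1" using level0 level1 by auto
  \<comment> \<open>The sign condition turns \<open>\<bar>t\<bar>\<close> into \<open>- t\<close>,
    that is, into minus the payoff.\<close>
  have low: "\<exists>t\<in>Y. t \<le> - N \<and> t \<le> 0" if bb: "\<not> bdd_below Y" for Y :: "real set" and N
  proof -
    obtain t where "t \<in> Y" "\<not> min (- N) 0 \<le> t" using bb unfolding bdd_below_def by blast
    then show ?thesis by (intro bexI[of _ t]) auto
  qed
  let ?A = "\<lambda>t z. \<integral>s. cost_marg s (t, z) \<partial>\<mu>" and ?B = "\<lambda>t z. \<integral>s. cost_marg s (t, z) \<partial>\<nu>"
  have A: "?A t z \<le> (\<integral>s. \<bar>fst s\<bar> \<partial>\<mu>) + (\<integral>s. norm (snd s) \<partial>\<mu>) + \<bar>t\<bar> + norm z" for t z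
    by (rule cost_to_point(2)[OF prob_mu sets_mu int_mu])
  have B: "?B t z \<le> (\<integral>s. \<bar>fst s\<bar> \<partial>\<nu>) + (\<integral>s. norm (snd s) \<partial>\<nu>) + \<bar>t\<bar> + norm z" for t z
    by (rule cost_to_point(2)[OF prob_nu sets_nu int_nu])
  obtain w1 w2 where w: "w1 \<in> \<Y>1" "w2 \<in> \<Y>2" using low[OF Y(1)] low[OF Y(2)] by blast
  show "1 \<le> l1"
  proof (rule multiplier_ge_1[OF l(1)])
    fix N
    obtain t where t: "t \<in> \<Y>1" "t \<le> - N" "t \<le> 0" using low[OF Y(1)] by blast
    have "v \<le> t + l1 * (?A t z0 - \<delta>1) + l2 * (?B w2 z0 - \<delta>2)"
      using v[OF attainable_constant[OF \<pi> t(1) w(2) z(1)]] z(2) by simp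
    then show "\<exists>a r. r \<le> - N \<and> a \<le> ((\<integral>s. \<bar>fst s\<bar> \<partial>\<mu>) + (\<integral>s. norm (snd s) \<partial>\<mu>) + norm z0 - \<delta>1) - r \<and>
        v - l2 * (?B w2 z0 - \<delta>2) \<le> r + l1 * a"
      using t A[of t z0] by (intro exI[of _ "?A t z0 - \<delta>1"] exI[of _ t]) auto
  qed
  show "1 \<le> l2"
  proof (rule multiplier_ge_1[OF l(2)])
    fix N
    obtain t where t: "t \<in> \<Y>2" "t \<le> - N" "t \<le> 0" using low[OF Y(2)] by blast
    have "v \<le> t + l1 * (?A w1 z1 - \<delta>1) + l2 * (?B t z1 - \<delta>2)"
      using v[OF attainable_constant[OF \<pi> w(1) t(1) z(3)]] z(4) by simp
    then show "\<exists>a r. r \<le> - N \<and> a \<le> ((\<integral>s. \<bar>fst s\<bar> \<partial>\<nu>) + (\<integral>s. norm (snd s) \<partial>\<nu>) + norm z1 - \<delta>2) - r \<and>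
        v - l1 * (?A w1 z1 - \<delta>1) \<le> r + l2 * a"
      using t B[of t z1] by (intro exI[of _ "?B t z1 - \<delta>2"] exI[of _ t]) auto
  qed
qed

text \<open>Converse of the pointwise bound: keeping the outcomes and moving the covariates
  near-optimally into the cheaper level set reaches \<open>gain\<close> up to \<open>e\<close> at
  every pair of sources.\<close>

lemma near_optimal_move:
  assumes \<pi>: "\<pi> \<in> couplings \<mu> \<nu>" and l: "1 \<le> l1" "1 \<le> l2" and e: "0 < e"
  shows "\<exists>a b r. (a, b, r) \<in> attainable \<and> r + l1 * a + l2 * b \<le> (\<integral>v. gain l1 l2 v \<partial>\<pi>) + e"
proof -
  have l0: "0 \<le> l1" "0 \<le> l2" using l by auto
  have s: "sets \<pi> = sets (\<mu> \<Otimes>\<^sub>M \<nu>)" and dd: "distr \<pi> \<mu> fst = \<mu>" "distr \<pi> \<nu> snd = \<nu>" and "prob_space \<pi>"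
    using \<pi> by (auto simp: couplings_def)
  interpret \<pi>: prob_space \<pi> by fact
  let ?c = "\<lambda>x p. l1 * norm (fst p - x) + l2 * norm (snd p - x)"
  let ?sc = "\<lambda>j p. switch_cost \<X> d j l1 l2 (fst p) (snd p)"
  let ?x = "\<lambda>v :: (real \<times> (real ^ 'q)) \<times> real \<times> (real ^ 'q). (snd (fst v), snd (snd v))"
  obtain h0 where h0: "h0 \<in> borel \<rightarrow>\<^sub>M borel" "\<And>p. h0 p \<in> \<X>" "\<And>p. d (h0 p) = 0" "\<And>p. ?c (h0 p) p \<le> ?sc 0 p + e"
    using near_optimal_switch[OF level0 l0 e] by metis
  obtain h1 where h1: "h1 \<in> borel \<rightarrow>\<^sub>M borel" "\<And>p. h1 p \<in> \<X>" "\<And>p. d (h1 p) = 1" "\<And>p. ?c (h1 p) p \<le> ?sc 1 p + e"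
    using near_optimal_switch[OF level1 l0 e] by metis
  define sel where "sel = (\<lambda>v. if fst (snd v) + ?sc 1 (?x v) < fst (fst v) + ?sc 0 (?x v) then h1 (?x v) else h0 (?x v))"
  define h where "h = (\<lambda>v :: (real \<times> (real ^ 'q)) \<times> real \<times> (real ^ 'q). (fst (fst v), fst (snd v), sel v))"
  have xb: "?x \<in> borel \<rightarrow>\<^sub>M borel" by (intro borel_measurable_continuous_onI continuous_intros)
  have scm: "(\<lambda>v. ?sc j (?x v)) \<in> borel_measurable borel" if "\<exists>x\<in>\<X>. d x = j" for j
    by (rule measurable_compose[OF xb borel_measurable_continuous_onI[OF continuous_switch_cost[OF that l0]]])
  have [measurable]: "(\<lambda>v. fst (fst v)) \<in> borel_measurable (borel :: ((real \<times> (real ^ 'q)) \<times> real \<times> (real ^ 'q)) measure)"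
    "(\<lambda>v. fst (snd v)) \<in> borel_measurable (borel :: ((real \<times> (real ^ 'q)) \<times> real \<times> (real ^ 'q)) measure)"
    by (intro borel_measurable_continuous_onI continuous_intros)+
  note [measurable] = scm[OF level0] scm[OF level1] measurable_compose[OF xb h0(1)] measurable_compose[OF xb h1(1)]
  have "sel \<in> borel_measurable borel"
    unfolding sel_def by (intro measurable_If) measurable
  then have "h \<in> borel_measurable borel"
    unfolding h_def by (intro borel_measurable_Pair) measurable
  then have hb: "h \<in> borel_measurable (\<mu> \<Otimes>\<^sub>M \<nu>)" by (rule measurable_compose[OF ident_sources])
  have h: "h \<in> \<mu> \<Otimes>\<^sub>M \<nu> \<rightarrow>\<^sub>M outcomes"
  proof (rule measurable_into_borel_on[OF hb _ refl])
    fix v assume "v \<in> space (\<mu> \<Otimes>\<^sub>M \<nu>)"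
    then show "h v \<in> \<Y>1 \<times> \<Y>2 \<times> \<X>"
      using h0(2) h1(2) space_borel_on[OF sets_mu] space_borel_on[OF sets_nu]
      by (auto simp: h_def sel_def space_pair_measure)
  qed
  have pt: "payoff (h v) + l1 * cost1 (v, h v) + l2 * cost2 (v, h v) \<le> gain l1 l2 v + e" for v
    using h0(3,4)[of "?x v"] h1(3,4)[of "?x v"]
    by (auto simp: payoff_def h_def sel_def cost1_def cost2_def cost_marg_def gain_def case_prod_unfold min_def)
  have nn: "0 \<le> cost1 z" "0 \<le> cost2 z" for z by (simp_all add: cost1_def cost2_def cost_marg_nonneg)
  have lc: "cost1 z \<le> l1 * cost1 z" "cost2 z \<le> l2 * cost2 z" for z
    using l nn[of z] mult_right_mono[of 1 l1 "cost1 z"] mult_right_mono[of 1 l2 "cost2 z"] by auto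
  have pb: "\<bar>payoff (h v)\<bar> \<le> \<bar>fst (fst v)\<bar> + \<bar>fst (snd v)\<bar>" for v
    using h0(3)[of "?x v"] h1(3)[of "?x v"] by (auto simp: payoff_def h_def sel_def)
  have hp: "(\<lambda>v. (v, h v)) \<in> \<pi> \<rightarrow>\<^sub>M moves" and h': "h \<in> \<pi> \<rightarrow>\<^sub>M outcomes"
    unfolding measurable_cong_sets[OF s refl] by (intro measurable_Pair measurable_ident_sets[OF refl] h)+
  note m = measurable_compose[OF hp cost_measurable(1)] measurable_compose[OF hp cost_measurable(2)]
    measurable_compose[OF h' payoff_measurable]
  let ?b = "\<lambda>v. \<bar>fst (fst v)\<bar> + \<bar>fst (snd v)\<bar>"
  have ib: "integrable \<pi> ?b"
    by (intro Bochner_Integration.integrable_add integrable_abs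
        integral_marginal(1)[OF dd(1) coupling_measurable(1)[OF \<pi>] int_mu(1)]
        integral_marginal(1)[OF dd(2) coupling_measurable(2)[OF \<pi>] int_nu(1)])
  have ig: "integrable \<pi> (gain l1 l2)" by (rule gain_integrable[OF \<pi> l0])
  have ip: "integrable \<pi> (\<lambda>v. payoff (h v))"
    by (rule Bochner_Integration.integrable_bound[OF ib m(3)], rule AE_I2) (use pb in \<open>fastforce\<close>)
  \<comment> \<open>Since the costs are nonnegative and the multipliers at least 1, the pointwise
    bound dominates each cost by this function. Integrability of the costs thus follows without a
    growth bound on the selected points.\<close>
  have iB: "integrable \<pi> (\<lambda>v. (gain l1 l2 v + e) - payoff (h v))"
    by (intro Bochner_Integration.integrable_add Bochner_Integration.integrable_diff ig ip \<pi>.integrable_const)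
  have i1: "integrable \<pi> (\<lambda>v. cost1 (v, h v))"
  proof (rule Bochner_Integration.integrable_bound[OF iB m(1)], rule AE_I2)
    fix v
    show "norm (cost1 (v, h v)) \<le> norm ((gain l1 l2 v + e) - payoff (h v))"
      using pt[of v] nn[of "(v, h v)"] lc[of "(v, h v)"] unfolding real_norm_def by linarith
  qed
  have i2: "integrable \<pi> (\<lambda>v. cost2 (v, h v))"
  proof (rule Bochner_Integration.integrable_bound[OF iB m(2)], rule AE_I2)
    fix v
    show "norm (cost2 (v, h v)) \<le> norm ((gain l1 l2 v + e) - payoff (h v))"
      using pt[of v] nn[of "(v, h v)"] lc[of "(v, h v)"] unfolding real_norm_def by linarith
  qed
  have "(\<integral>v. payoff (h v) \<partial>\<pi>) + l1 * (\<integral>v. cost1 (v, h v) \<partial>\<pi>) + l2 * (\<integral>v. cost2 (v, h v) \<partial>\<pi>)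
      = (\<integral>v. payoff (h v) + l1 * cost1 (v, h v) + l2 * cost2 (v, h v) \<partial>\<pi>)"
    using i1 i2 ip by simp
  also have "\<dots> \<le> (\<integral>v. gain l1 l2 v + e \<partial>\<pi>)"
    using i1 i2 ip ig pt by (intro integral_mono) auto
  also have "\<dots> = (\<integral>v. gain l1 l2 v \<partial>\<pi>) + e" using ig by (simp add: \<pi>.prob_space)
  finally show ?thesis using attainable_map[OF \<pi> h i1 i2 ip] by blast
qed

text \<open>A joint law with the given margins is turned into a coupling whose two sources share
  their covariate almost surely. Leaving everything in place then costs nothing on either
  side.\<close>

lemma slater_point:
  assumes \<gamma>: "prob_space \<gamma>" "sets \<gamma> = sets outcomes"
    and d1: "distr \<gamma> \<mu> (\<lambda>s. (fst s, snd (snd s))) = \<mu>" and d2: "distr \<gamma> \<nu> snd = \<nu>"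
  shows "\<exists>\<pi> r. \<pi> \<in> couplings \<mu> \<nu> \<and> (0, 0, r) \<in> attainable"
proof -
  interpret \<gamma>: prob_space \<gamma> by fact
  note mg = measurable_cong_sets[OF \<gamma>(2) refl]
  have m1: "(\<lambda>s. (fst s, snd (snd s))) \<in> \<gamma> \<rightarrow>\<^sub>M \<mu>" and m2: "snd \<in> \<gamma> \<rightarrow>\<^sub>M \<nu>"
    by (rule measurable_into_borel_on[OF measurable_borel_on[OF _ \<gamma>(2)]];
      auto simp: space_borel_on[OF \<gamma>(2)] sets_mu sets_nu intro!: borel_measurable_continuous_onI continuous_intros)+
  let ?k = "\<lambda>s. ((fst s, snd (snd s)), snd s)"
  have k: "?k \<in> \<gamma> \<rightarrow>\<^sub>M \<mu> \<Otimes>\<^sub>M \<nu>" by (rule measurable_Pair[OF m1 m2])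
  define \<pi> where "\<pi> = distr \<gamma> (\<mu> \<Otimes>\<^sub>M \<nu>) ?k"
  have \<pi>: "\<pi> \<in> couplings \<mu> \<nu>"
    using \<gamma>.prob_space_distr[OF k] d1 d2
    by (simp add: couplings_def \<pi>_def distr_distr[OF measurable_fst k] distr_distr[OF measurable_snd k] comp_def)
  \<comment> \<open>The move must be defined on all pairs of sources, so the target covariate is
    read off the first one. On the image of \<open>?k\<close> both sources carry it and both costs
    vanish.\<close>
  let ?h = "\<lambda>v :: (real \<times> (real ^ 'q)) \<times> real \<times> (real ^ 'q). (fst (fst v), fst (snd v), snd (fst v))"
  have "?h \<in> borel_measurable borel" by (intro borel_measurable_continuous_onI continuous_intros)
  then have hb: "?h \<in> borel_measurable (\<mu> \<Otimes>\<^sub>M \<nu>)" by (rule measurable_compose[OF ident_sources])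
  have h: "?h \<in> \<mu> \<Otimes>\<^sub>M \<nu> \<rightarrow>\<^sub>M outcomes"
    by (rule measurable_into_borel_on[OF hb _ refl])
      (auto simp: space_pair_measure space_borel_on[OF sets_mu] space_borel_on[OF sets_nu])
  have hp: "(\<lambda>v. (v, ?h v)) \<in> \<mu> \<Otimes>\<^sub>M \<nu> \<rightarrow>\<^sub>M moves"
    by (intro measurable_Pair measurable_ident_sets[OF refl] h)
  note m = measurable_compose[OF hp cost_measurable(1)] measurable_compose[OF hp cost_measurable(2)]
    measurable_compose[OF h payoff_measurable]
  have z: "cost1 (?k s, ?h (?k s)) = 0" "cost2 (?k s, ?h (?k s)) = 0" for s
    by (simp_all add: cost1_def cost2_def cost_marg_def case_prod_unfold)
  have i: "integrable \<pi> (\<lambda>v. cost1 (v, ?h v))" "integrable \<pi> (\<lambda>v. cost2 (v, ?h v))"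
    and e: "(\<integral>v. cost1 (v, ?h v) \<partial>\<pi>) = 0" "(\<integral>v. cost2 (v, ?h v) \<partial>\<pi>) = 0"
    unfolding \<pi>_def using z
    by (simp_all add: integrable_distr_eq[OF k m(1)] integrable_distr_eq[OF k m(2)]
      integral_distr[OF k m(1)] integral_distr[OF k m(2)])
  have ip: "integrable \<pi> (\<lambda>v. payoff (?h v))"
    unfolding \<pi>_def
  proof (subst integrable_distr_eq[OF k m(3)])
    have f1: "integrable \<gamma> (\<lambda>s. fst s)" using integral_marginal(1)[OF d1 m1 int_mu(1)] by simp
    have f2: "integrable \<gamma> (\<lambda>s. fst (snd s))" using integral_marginal(1)[OF d2 m2 int_nu(1)] by simp
    have "payoff \<in> borel_measurable \<gamma>" using payoff_measurable by (simp only: mg)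
    then have "integrable \<gamma> payoff"
    proof (rule Bochner_Integration.integrable_bound[OF
          Bochner_Integration.integrable_add[OF integrable_abs[OF f1] integrable_abs[OF f2]]], intro AE_I2)
      fix s assume "s \<in> space \<gamma>"
      then have "snd (snd s) \<in> \<X>" by (auto simp: space_borel_on[OF \<gamma>(2)])
      from d_range[OF this] show "norm (payoff s) \<le> norm (\<bar>fst s\<bar> + \<bar>fst (snd s)\<bar>)"
        by (auto simp: payoff_def)
    qed
    then show "integrable \<gamma> (\<lambda>s. payoff (?h (?k s)))" by simp
  qed
  show ?thesis using attainable_map[OF \<pi> h i ip] \<pi> unfolding e by blast
qed

lemma strong_duality:
  assumes Y: "\<not> bdd_below \<Y>1" "\<not> bdd_below \<Y>2" and \<delta>: "0 < \<delta>1" "0 < \<delta>2"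
    and slater: "\<pi>0 \<in> couplings \<mu> \<nu>" "(0, 0, r0) \<in> attainable"
  shows "robust_welfare d (ambiguity_set \<Y>1 \<Y>2 \<X> \<mu> \<nu> \<delta>1 \<delta>2) \<le> dual_welfare \<X> d \<mu> \<nu> \<delta>1 \<delta>2"
    (is "?RW \<le> ?D")
proof -
  \<comment> \<open>The primal value is an extended real, while the separation needs a real level;
    comparing all real levels below it covers the infinite cases too.\<close>
  have bound: "ereal v \<le> ?D" if v: "ereal v \<le> ?RW" for v
  proof -
    have low: "v \<le> r" if "(a, b, r) \<in> attainable" "a \<le> \<delta>1" "b \<le> \<delta>2" for a b r
      using order_trans[OF v robust_welfare_le_attainable[OF that]] by simp
    obtain l1 l2 where l0: "0 \<le> l1" "0 \<le> l2"
      and "\<forall>a b r. (a, b, r) \<in> attainable \<longrightarrow> v \<le> r + l1 * (a - \<delta>1) + l2 * (b - \<delta>2)"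
      using lagrange_multipliers[OF convex_attainable slater(2) \<delta> low] .
    then have lag: "\<And>a b r. (a, b, r) \<in> attainable \<Longrightarrow> v \<le> r + l1 * (a - \<delta>1) + l2 * (b - \<delta>2)"
      by blast
    note l = multipliers_ge_1[OF slater(1) Y l0 lag]
    let ?I = "INF \<pi>\<in>couplings \<mu> \<nu>. ereal (\<integral>v. gain l1 l2 v \<partial>\<pi>)"
    have "ereal (v + (l1 * \<delta>1 + l2 * \<delta>2)) \<le> ?I"
    proof (rule INF_greatest)
      fix \<pi> assume \<pi>: "\<pi> \<in> couplings \<mu> \<nu>"
      have "v + (l1 * \<delta>1 + l2 * \<delta>2) \<le> (\<integral>v. gain l1 l2 v \<partial>\<pi>)"
      proof (rule field_le_epsilon)
        fix e :: real assume "0 < e"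
        then obtain a b r where "(a, b, r) \<in> attainable" "r + l1 * a + l2 * b \<le> (\<integral>v. gain l1 l2 v \<partial>\<pi>) + e"
          using near_optimal_move[OF \<pi> l] by blast
        with lag[OF this(1)] show "v + (l1 * \<delta>1 + l2 * \<delta>2) \<le> (\<integral>v. gain l1 l2 v \<partial>\<pi>) + e"
          by (simp add: algebra_simps)
      qed
      then show "ereal (v + (l1 * \<delta>1 + l2 * \<delta>2)) \<le> ereal (\<integral>v. gain l1 l2 v \<partial>\<pi>)" by simp
    qed
    then have "ereal v \<le> ?I - ereal (l1 * \<delta>1 + l2 * \<delta>2)" by (cases ?I) auto
    also have "\<dots> \<le> ?D" unfolding dual_welfare_eq using l by (intro SUP_upper2[of "(l1, l2)"]) auto
    finally show ?thesis .
  qed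
  show ?thesis
  proof (cases ?RW)
    case (real r)
    then show ?thesis using bound[of r] by simp
  next
    case PInf
    then have "?D = \<infinity>" using bound by (intro ereal_top) simp
    then show ?thesis by simp
  qed simp
qed

lemma dual_welfare_antimono:
  assumes "\<delta>1 \<le> \<epsilon>1" "\<delta>2 \<le> \<epsilon>2"
  shows "dual_welfare \<X> d \<mu> \<nu> \<epsilon>1 \<epsilon>2 \<le> dual_welfare \<X> d \<mu> \<nu> \<delta>1 \<delta>2"
  unfolding dual_welfare_eq
proof (rule SUP_mono, rule bexI)
  fix l :: "real \<times> real" assume l: "l \<in> {1..} \<times> {1..}"
  then have "fst l * \<delta>1 + snd l * \<delta>2 \<le> fst l * \<epsilon>1 + snd l * \<epsilon>2"
    using assms by (intro add_mono mult_left_mono) auto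
  then show "(case l of (l1, l2) \<Rightarrow> (INF \<pi>\<in>couplings \<mu> \<nu>. ereal (\<integral>v. gain l1 l2 v \<partial>\<pi>)) - ereal (l1 * \<epsilon>1 + l2 * \<epsilon>2))
    \<le> (case l of (l1, l2) \<Rightarrow> (INF \<pi>\<in>couplings \<mu> \<nu>. ereal (\<integral>v. gain l1 l2 v \<partial>\<pi>)) - ereal (l1 * \<delta>1 + l2 * \<delta>2))"
    by (cases l) (auto intro!: ereal_minus_mono)
qed simp

end

theorem proposition6p5:
  fixes M :: "'w measure"
    and Y1 Y2 :: "'w \<Rightarrow> real" and X :: "'w \<Rightarrow> real ^ 'q"
    and \<Y>1 \<Y>2 :: "real set" and \<X> :: "(real ^ 'q) set"
    and \<mu>13 \<mu>23 :: "(real \<times> (real ^ 'q)) measure"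
    and d :: "real ^ 'q \<Rightarrow> real"
    and \<delta>1 \<delta>2 :: real
    and RW :: "real \<Rightarrow> real \<Rightarrow> ereal"
  assumes "polish_subset \<Y>1" and "polish_subset \<Y>2" and "polish_subset \<X>"
    and "prob_space M"
    and "Y1 \<in> M \<rightarrow>\<^sub>M borel_on \<Y>1" and "Y2 \<in> M \<rightarrow>\<^sub>M borel_on \<Y>2" and "X \<in> M \<rightarrow>\<^sub>M borel_on \<X>"
    and "\<mu>13 = distr M (borel_on (\<Y>1 \<times> \<X>)) (\<lambda>\<omega>. (Y1 \<omega>, X \<omega>))"
    and "\<mu>23 = distr M (borel_on (\<Y>2 \<times> \<X>)) (\<lambda>\<omega>. (Y2 \<omega>, X \<omega>))"
    and "d \<in> borel_measurable (borel_on \<X>)" and "\<forall>x\<in>\<X>. d x \<in> {0, 1}"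
    and "\<not> bdd_below \<Y>1" and "\<not> bdd_below \<Y>2"
    and "integrable M (\<lambda>\<omega>. \<bar>Y1 \<omega>\<bar>)" and "integrable M (\<lambda>\<omega>. \<bar>Y2 \<omega>\<bar>)"
    and "integrable M (\<lambda>\<omega>. (norm (X \<omega>))\<^sup>2)"
    and "0 \<le> \<delta>1" and "0 \<le> \<delta>2"
    and "\<And>\<epsilon>1 \<epsilon>2. RW \<epsilon>1 \<epsilon>2 = robust_welfare d (ambiguity_set \<Y>1 \<Y>2 \<X> \<mu>13 \<mu>23 \<epsilon>1 \<epsilon>2)"
  shows "((\<exists>x\<in>\<X>. d x = 0) \<and> (\<exists>x\<in>\<X>. d x = 1) \<and>
          (\<delta>1 = 0 \<or> \<delta>2 = 0 \<longrightarrow> ((\<lambda>\<epsilon>. RW (\<delta>1 + \<epsilon>) (\<delta>2 + \<epsilon>)) \<longlongrightarrow> RW \<delta>1 \<delta>2) (at_right 0))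
            \<longrightarrow> RW \<delta>1 \<delta>2 = dual_welfare \<X> d \<mu>13 \<mu>23 \<delta>1 \<delta>2)
       \<and> (\<forall>\<delta>0 \<pi>s. \<delta>0 = \<delta>1 \<and> \<delta>0 = \<delta>2 \<and> neg_dependent_reference \<Y>1 \<Y>2 \<X> \<mu>13 \<mu>23 \<pi>s
            \<longrightarrow> RW \<delta>1 \<delta>2 \<le> robust_welfare d (ambiguity_set_ref \<Y>1 \<Y>2 \<X> \<pi>s \<delta>0))"
proof -
  interpret M: prob_space M by fact
  note Y1m = \<open>Y1 \<in> M \<rightarrow>\<^sub>M borel_on \<Y>1\<close> and Y2m = \<open>Y2 \<in> M \<rightarrow>\<^sub>M borel_on \<Y>2\<close> and Xm = \<open>X \<in> M \<rightarrow>\<^sub>M borel_on \<X>\<close>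
  note mu = \<open>\<mu>13 = distr M (borel_on (\<Y>1 \<times> \<X>)) (\<lambda>\<omega>. (Y1 \<omega>, X \<omega>))\<close>
    and nu = \<open>\<mu>23 = distr M (borel_on (\<Y>2 \<times> \<X>)) (\<lambda>\<omega>. (Y2 \<omega>, X \<omega>))\<close>
  note RW = \<open>\<And>\<epsilon>1 \<epsilon>2. RW \<epsilon>1 \<epsilon>2 = robust_welfare d (ambiguity_set \<Y>1 \<Y>2 \<X> \<mu>13 \<mu>23 \<epsilon>1 \<epsilon>2)\<close>
  have b: "Y1 \<in> borel_measurable M" "Y2 \<in> borel_measurable M" "X \<in> borel_measurable M"
    using Y1m Y2m Xm by (auto simp: measurable_restrict_space2_iff)
  have sp: "Y1 \<omega> \<in> \<Y>1" "Y2 \<omega> \<in> \<Y>2" "X \<omega> \<in> \<X>" if "\<omega> \<in> space M" for \<omega>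
    using measurable_space[OF Y1m that] measurable_space[OF Y2m that] measurable_space[OF Xm that]
    by (auto simp: space_restrict_space)
  have p1: "(\<lambda>\<omega>. (Y1 \<omega>, X \<omega>)) \<in> M \<rightarrow>\<^sub>M borel_on (\<Y>1 \<times> \<X>)"
    and p2: "(\<lambda>\<omega>. (Y2 \<omega>, X \<omega>)) \<in> M \<rightarrow>\<^sub>M borel_on (\<Y>2 \<times> \<X>)"
    and p3: "(\<lambda>\<omega>. (Y1 \<omega>, Y2 \<omega>, X \<omega>)) \<in> M \<rightarrow>\<^sub>M borel_on (\<Y>1 \<times> \<Y>2 \<times> \<X>)"
    using sp by (auto intro!: measurable_into_borel_on[OF _ _ refl] borel_measurable_Pair b)
  have P: "prob_space \<mu>13" "prob_space \<mu>23"
    unfolding mu nu by (rule M.prob_space_distr[OF p1] M.prob_space_distr[OF p2])+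
  have S: "sets \<mu>13 = sets (borel_on (\<Y>1 \<times> \<X>))" "sets \<mu>23 = sets (borel_on (\<Y>2 \<times> \<X>))"
    by (simp_all add: mu nu)
  have sn: "snd \<in> borel_on (A \<times> \<X>) \<rightarrow>\<^sub>M borel_on \<X>" for A :: "real set"
    by (rule measurable_into_borel_on[OF measurable_borel_on[OF _ refl] _ refl])
      (auto simp: space_restrict_space intro!: borel_measurable_continuous_onI continuous_intros)
  have cov: "distr \<mu>13 (borel_on \<X>) snd = distr \<mu>23 (borel_on \<X>) snd"
    unfolding mu nu by (simp add: distr_distr[OF sn p1] distr_distr[OF sn p2] comp_def)
  have ii: "RW \<delta>1 \<delta>2 \<le> robust_welfare d (ambiguity_set_ref \<Y>1 \<Y>2 \<X> \<pi>s \<delta>0)"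
    if "\<delta>0 = \<delta>1" "\<delta>0 = \<delta>2" "neg_dependent_reference \<Y>1 \<Y>2 \<X> \<mu>13 \<mu>23 \<pi>s" for \<delta>0 \<pi>s
    unfolding RW robust_welfare_def that(1,2)[symmetric]
    by (rule INF_superset_mono[OF ambiguity_set_ref_subset[OF that(3) P(1) S(1) P(2) S(2) cov] order_refl])
  have i: "RW \<delta>1 \<delta>2 = dual_welfare \<X> d \<mu>13 \<mu>23 \<delta>1 \<delta>2"
    if lev: "\<exists>x\<in>\<X>. d x = 0" "\<exists>x\<in>\<X>. d x = 1"
      and lim: "\<delta>1 = 0 \<or> \<delta>2 = 0 \<longrightarrow> ((\<lambda>\<epsilon>. RW (\<delta>1 + \<epsilon>) (\<delta>2 + \<epsilon>)) \<longlongrightarrow> RW \<delta>1 \<delta>2) (at_right 0)"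
  proof -
    have iX: "integrable M (\<lambda>\<omega>. norm (X \<omega>))"
      by (rule M.square_integrable_imp_integrable) (use b assms(16) in auto)
    have iY: "integrable M Y1" "integrable M Y2"
      using integrable_abs_cancel[OF assms(14) b(1)] integrable_abs_cancel[OF assms(15) b(2)] .
    have m: "fst \<in> borel_on A \<rightarrow>\<^sub>M (borel :: real measure)" "(\<lambda>s. norm (snd s)) \<in> borel_measurable (borel_on A)"
      for A :: "(real \<times> (real ^ 'q)) set"
      by (rule measurable_borel_on[OF _ refl]; intro borel_measurable_continuous_onI continuous_intros)+
    have "integrable \<mu>13 fst" "integrable \<mu>13 (\<lambda>s. norm (snd s))"
      "integrable \<mu>23 fst" "integrable \<mu>23 (\<lambda>s. norm (snd s))"
      unfolding mu nu using iX iY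
      by (simp_all add: integrable_distr_eq[OF p1 m(1)] integrable_distr_eq[OF p1 m(2)]
        integrable_distr_eq[OF p2 m(1)] integrable_distr_eq[OF p2 m(2)])
    then interpret outcome_marginals \<Y>1 \<Y>2 \<X> \<mu>13 \<mu>23 d
      using assms(11) by (intro outcome_marginals.intro P S assms(10) lev) auto
    have q1: "(\<lambda>s. (fst s, snd (snd s))) \<in> outcomes \<rightarrow>\<^sub>M \<mu>13" and q2: "snd \<in> outcomes \<rightarrow>\<^sub>M \<mu>23"
      by (rule measurable_into_borel_on[OF measurable_borel_on[OF _ refl]];
        auto simp: space_restrict_space S intro!: borel_measurable_continuous_onI continuous_intros)+
    \<comment> \<open>The law of \<open>(Y1, Y2, X)\<close> has the required projections and so
      supplies both the zero-cost plan and a coupling of the margins.\<close>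
    have "distr (distr M outcomes (\<lambda>\<omega>. (Y1 \<omega>, Y2 \<omega>, X \<omega>))) \<mu>13 (\<lambda>s. (fst s, snd (snd s))) = \<mu>13"
      by (subst distr_distr[OF q1 p3]) (auto simp: comp_def mu intro: distr_cong)
    moreover have "distr (distr M outcomes (\<lambda>\<omega>. (Y1 \<omega>, Y2 \<omega>, X \<omega>))) \<mu>23 snd = \<mu>23"
      by (subst distr_distr[OF q2 p3]) (auto simp: comp_def nu intro: distr_cong)
    ultimately obtain \<pi>0 r0 where slater: "\<pi>0 \<in> couplings \<mu>13 \<mu>23" "(0, 0, r0) \<in> attainable"
      using slater_point[OF M.prob_space_distr[OF p3] sets_distr] by blast
    have strong: "RW \<epsilon>1 \<epsilon>2 \<le> dual_welfare \<X> d \<mu>13 \<mu>23 \<epsilon>1 \<epsilon>2" if "0 < \<epsilon>1" "0 < \<epsilon>2" for \<epsilon>1 \<epsilon>2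
      unfolding RW using assms(12,13) that slater by (rule strong_duality)
    have "RW \<delta>1 \<delta>2 \<le> dual_welfare \<X> d \<mu>13 \<mu>23 \<delta>1 \<delta>2"
    proof (cases "\<delta>1 = 0 \<or> \<delta>2 = 0")
      case True
      show ?thesis
      proof (rule tendsto_upperbound)
        show "((\<lambda>\<epsilon>. RW (\<delta>1 + \<epsilon>) (\<delta>2 + \<epsilon>)) \<longlongrightarrow> RW \<delta>1 \<delta>2) (at_right 0)" using lim True by blast
        \<comment> \<open>The positive-radius bound at the enlarged radii is weakened to the fixed
          dual value at the original ones by antitonicity, so that only the left side varies in the
          limit.\<close>
        have "RW (\<delta>1 + \<epsilon>) (\<delta>2 + \<epsilon>) \<le> dual_welfare \<X> d \<mu>13 \<mu>23 \<delta>1 \<delta>2" if "0 < \<epsilon>" for \<epsilon>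
          using \<open>0 \<le> \<delta>1\<close> \<open>0 \<le> \<delta>2\<close> that by (intro order_trans[OF strong dual_welfare_antimono]) auto
        then show "\<forall>\<^sub>F \<epsilon> in at_right 0. RW (\<delta>1 + \<epsilon>) (\<delta>2 + \<epsilon>) \<le> dual_welfare \<X> d \<mu>13 \<mu>23 \<delta>1 \<delta>2"
          by (auto simp: eventually_at_right_field intro: exI[of _ 1])
      qed simp
    next
      case False
      then show ?thesis using \<open>0 \<le> \<delta>1\<close> \<open>0 \<le> \<delta>2\<close> by (intro strong) auto
    qed
    then show ?thesis using weak_duality[OF \<open>0 \<le> \<delta>1\<close> \<open>0 \<le> \<delta>2\<close>] by (auto simp: RW intro: order_antisym)
  qed
  from i ii show ?thesis by blast
qed



end
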